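(* Let $d,k,m,B$ be positive integers and $Q_1,Q_2>0$. Let $A$ be a complex $mB\times d$ matrix all of whose entries have modulus at most $1$, with rows $a_1,\dots,a_{mB}$, and for $b\in[m]$ let $A_b$ be the $B\times d$ matrix with rows $a_{B(b-1)+1},\dots,a_{B(b-1)+B}$. Suppose that for every integer $1\le s\le 2k$, $$\max_{b\in[m]}\sup_{x\in T_s}\|A_bx\|_2\le Q_1\sqrt{B}+Q_2\sqrt{s},$$ and suppose that $B\ge\max\{Q_2^2\log^2m,\;Q_1^2\log m\log k\}$ and $k\ge Q_1^2\log^2m$. Then, with $\|x\|_X:=\max_{b\in[m]}\|A_bx\|_2$, $$\gamma_2(T_k,\|\cdot\|_X)\lesssim\sqrt{kB\log d}\cdot\log(Bk).$$
   Context: $T_s=\{x\in\mathbb{C}^d:\ x\text{ has at most }s\text{ nonzero entries},\ \|x\|_2\le1\}$. Talagrand's functional: for a set $T$ with (pseudo)metric $\rho$, an admissible sequence is a sequence of subsets $A_1,A_2,\dots$ of $T$ with $|A_n|\le2^{2^n}$, and $\gamma_2(T,\rho)=\inf\sup_{t\in T}\sum_{n\ge1}2^{n/2}\rho(A_n,t)$, the infimum over admissible sequences, with $\rho(A_n,t)=\inf_{a\in A_n}\rho(a,t)$; here $\rho(x,y)=\|x-y\|_X$. $f\lesssim g$ means $f\le Cg$ for an absolute constant $C$.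
   Formalization: The formal theorem additionally assumes d ≥ 2 and Bk ≥ 2; when d = 1 or Bk = 1 the stated right-hand side is zero while γ₂ is positive for every nonzero A, so the claim fails there. *)

theory Defs
  imports
    Complex_Main
    "HOL-Library.Extended_Nonnegative_Real"
    "Jordan_Normal_Form.Matrix"
begin

definition l2norm :: "complex vec \<Rightarrow> real" where
  "l2norm x = sqrt (\<Sum>i<dim_vec x. (cmod (x $ i))\<^sup>2)"

definition sparse_ball :: "nat \<Rightarrow> nat \<Rightarrow> complex vec set" where
  "sparse_ball d s =
     {x \<in> carrier_vec d. card {i. i < d \<and> x $ i \<noteq> 0} \<le> s \<and> l2norm x \<le> 1}"

(* Blocks are numbered from 0, so block b consists of the rows B*b, ..., B*b + B - 1
   in the 0-based row indexing of the matrix library. *)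
definition row_block :: "nat \<Rightarrow> complex mat \<Rightarrow> nat \<Rightarrow> complex mat" where
  "row_block B A b = mat B (dim_col A) (\<lambda>(i, j). A $$ (B * b + i, j))"

definition norm_X :: "nat \<Rightarrow> nat \<Rightarrow> complex mat \<Rightarrow> complex vec \<Rightarrow> real" where
  "norm_X m B A x = (MAX b\<in>{..<m}. l2norm (row_block B A b *\<^sub>v x))"

(* Only the members with index n >= 1 matter; the value at 0 is left unconstrained. *)
definition admissible_seq :: "'a set \<Rightarrow> (nat \<Rightarrow> 'a set) \<Rightarrow> bool" where
  "admissible_seq T S \<longleftrightarrow>
     (\<forall>n\<ge>1. S n \<subseteq> T \<and> finite (S n) \<and> card (S n) \<le> 2 ^ (2 ^ n))"

(* Values are taken in [0, \<infinity>], where the infimum over an empty S n is \<infinity>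
   and every series converges.  The series runs over n >= 1, hence the shift by Suc. *)
definition gamma2 :: "'a set \<Rightarrow> ('a \<Rightarrow> 'a \<Rightarrow> real) \<Rightarrow> ennreal" where
  "gamma2 T \<rho> =
     (INF S\<in>{S. admissible_seq T S}. SUP t\<in>T.
        \<Sum>n. ennreal (2 powr (real (Suc n) / 2)) * (INF a\<in>S (Suc n). ennreal (\<rho> a t)))"

end

theory Submission
  imports Defs "HOL-Analysis.L2_Norm" "HOL-Analysis.Inner_Product"
begin

text \<open>
Chain with a sequence of nets, one for each \<open>n\<close>, in three ranges of \<open>n\<close>.  For small \<open>n\<close> the net is
the origin, and the assumed bound on the sparse operator norms controls the diameter.  For large \<open>n\<close>
a coordinatewise grid on every support suffices, with exponentially decreasing error.  In between,
a sparse vector is approximated by an average of \<open>L\<close> coordinate jumps, with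
\<open>L\<close> about \<open>2 ^ n / ln d\<close> (Maurey's empirical method); the error is of order \<open>sqrt (k B / L)\<close>, so
each such \<open>n\<close> contributes \<open>sqrt (k B ln d)\<close>, and there are only \<open>O(ln (B k))\<close> of them.

A union bound over the \<open>m\<close> blocks would cost a factor \<open>sqrt (ln m)\<close> if it used the variance
\<open>E |Y|\<^sup>2\<close> of a jump.  The exponential potential \<open>exp (\<theta> * sqrt (a\<^sup>2 + |u|\<^sup>2))\<close> sees that variance only
through a deterministic drift and otherwise the much smaller weak variance
\<open>sup |v| \<le> 1 of E \<langle>v, Y\<rangle>\<^sup>2\<close>, which is bounded by the squared operator norm on the support.
\<close>

subsection \<open>A vector Bernstein inequality\<close>

text \<open>For \<open>x = - y < 0\<close> the factor \<open>1 - y + y^2\<close> times the quadratic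
  Taylor lower bound of \<open>exp y\<close> equals \<open>1 + y^2/2 + y^3/2 + y^4/2\<close>, hence
  is at least 1; dividing by \<open>exp y\<close> gives the bound.\<close>

lemma exp_le_quadratic:
  fixes x :: real
  assumes "\<bar>x\<bar> \<le> 1"
  shows "exp x \<le> 1 + x + x\<^sup>2"
proof (cases "0 \<le> x")
  case True
  then show ?thesis using assms exp_bound by auto
next
  case False
  define y where "y = - x"
  have y: "0 \<le> y" "y \<le> 1" using False assms by (auto simp: y_def)
  have l: "1 + y + y\<^sup>2 / 2 \<le> exp y"
    using exp_lower_Taylor_quadratic[OF y(1)] by simp
  have pos: "0 < 1 + y + y\<^sup>2 / 2" using y by (intro add_pos_nonneg) auto
  have q: "0 \<le> 1 - y + y\<^sup>2" using y by (intro add_nonneg_nonneg) auto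
  have "1 \<le> 1 + y\<^sup>2 / 2 + y ^ 3 / 2 + y ^ 4 / 2" using y by simp
  also have "\<dots> = (1 - y + y\<^sup>2) * (1 + y + y\<^sup>2 / 2)"
    by (simp add: field_simps power2_eq_square power3_eq_cube power4_eq_xxxx)
  also have "\<dots> \<le> (1 - y + y\<^sup>2) * exp y" using l q by (rule mult_left_mono)
  finally have "exp (- y) \<le> 1 - y + y\<^sup>2" by (simp add: exp_minus field_simps)
  then show ?thesis by (simp add: y_def)
qed

text \<open>The Euclidean norm of \<open>u\<close> with one extra coordinate \<open>a\<close>. That
  coordinate keeps the vector away from 0, where the norm is not smooth, and limits the second-order
  term of an increment to order \<open>1 / a\<close>.\<close>

definition smooth_norm :: "'i set \<Rightarrow> real \<Rightarrow> ('i \<Rightarrow> 'a::real_inner) \<Rightarrow> real" where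
  "smooth_norm I a u = sqrt (a\<^sup>2 + (\<Sum>i\<in>I. (norm (u i))\<^sup>2))"

lemma smooth_norm_ge:
  assumes "0 \<le> a"
  shows "a \<le> smooth_norm I a u" "L2_set (\<lambda>i. norm (u i)) I \<le> smooth_norm I a u"
proof -
  have "sqrt (a\<^sup>2) \<le> smooth_norm I a u"
    unfolding smooth_norm_def by (intro real_sqrt_le_mono) (simp add: sum_nonneg)
  then show "a \<le> smooth_norm I a u" using assms by simp
  show "L2_set (\<lambda>i. norm (u i)) I \<le> smooth_norm I a u"
    unfolding smooth_norm_def L2_set_def by (intro real_sqrt_le_mono) simp
qed

text \<open>By concavity the square root lies below its tangent at \<open>?f^2\<close>; in the proof
  this is \<open>2 f g \<le> f^2 + g^2\<close> divided by \<open>2 f\<close>. The quadratic term is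
  then enlarged using \<open>a \<le> ?f\<close>.\<close>

lemma smooth_norm_add_le:
  fixes u y :: "'i \<Rightarrow> 'a::real_inner"
  assumes a: "0 < a"
  shows "smooth_norm I a (\<lambda>i. u i + y i) \<le> smooth_norm I a u
     + (\<Sum>i\<in>I. inner (u i) (y i)) / smooth_norm I a u + (\<Sum>i\<in>I. (norm (y i))\<^sup>2) / (2 * a)"
proof -
  let ?f = "smooth_norm I a u"
  let ?c = "\<Sum>i\<in>I. inner (u i) (y i)"
  let ?N = "\<Sum>i\<in>I. (norm (y i))\<^sup>2"
  have fa: "a \<le> ?f" using a by (intro smooth_norm_ge) simp
  have f0: "0 < ?f" using fa a by linarith
  have N0: "0 \<le> ?N" by (intro sum_nonneg) simp
  have f2: "?f\<^sup>2 = a\<^sup>2 + (\<Sum>i\<in>I. (norm (u i))\<^sup>2)"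
    unfolding smooth_norm_def by (intro real_sqrt_pow2) (simp add: sum_nonneg)
  have g2: "(smooth_norm I a (\<lambda>i. u i + y i))\<^sup>2 = a\<^sup>2 + (\<Sum>i\<in>I. (norm (u i + y i))\<^sup>2)"
    unfolding smooth_norm_def by (intro real_sqrt_pow2) (simp add: sum_nonneg)
  also have "(\<Sum>i\<in>I. (norm (u i + y i))\<^sup>2) = (\<Sum>i\<in>I. (norm (u i))\<^sup>2) + 2 * ?c + ?N"
    by (simp add: power2_norm_eq_inner inner_add_left inner_add_right inner_commute
        sum.distrib sum_distrib_left algebra_simps)
  finally have g2': "(smooth_norm I a (\<lambda>i. u i + y i))\<^sup>2 = ?f\<^sup>2 + 2 * ?c + ?N"
    using f2 by simp
  let ?g = "smooth_norm I a (\<lambda>i. u i + y i)"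
  have "2 * ?f * ?g \<le> ?f\<^sup>2 + ?g\<^sup>2" by (rule sum_squares_bound)
  also have "\<dots> = 2 * ?f\<^sup>2 + 2 * ?c + ?N" using g2' by simp
  finally have "2 * ?f * ?g \<le> 2 * ?f\<^sup>2 + 2 * ?c + ?N" .
  then have "?g \<le> (2 * ?f\<^sup>2 + 2 * ?c + ?N) / (2 * ?f)"
    using f0 by (simp add: field_simps)
  also have "\<dots> = ?f + ?c / ?f + ?N / (2 * ?f)"
    using f0 by (simp add: field_simps power2_eq_square)
  also have "?N / (2 * ?f) \<le> ?N / (2 * a)"
    using fa a N0 by (intro divide_left_mono) auto
  finally show ?thesis by simp
qed

text \<open>The first-order increment \<open>c j / f\<close> has mean zero, and its second moment is
  at most \<open>v\<close> because \<open>|u|^2 \<le> f^2\<close>. Apart from the smallness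
  condition on \<open>\<theta>\<close>, the jump size \<open>R\<close> enters only through the
  deterministic drift \<open>h\<close>.\<close>

lemma smooth_norm_exp_step:
  fixes u :: "'i \<Rightarrow> 'a::real_inner" and Y :: "'j \<Rightarrow> 'i \<Rightarrow> 'a"
  assumes p0: "\<And>j. j \<in> J \<Longrightarrow> 0 \<le> p j" and p1: "sum p J = 1"
    and R: "0 < R" "R \<le> a" and \<theta>: "0 \<le> \<theta>" "\<theta> * R \<le> 1/2"
    and bnd: "\<And>j. j \<in> J \<Longrightarrow> (\<Sum>i\<in>I. (norm (Y j i))\<^sup>2) \<le> R\<^sup>2"
    and mean: "(\<Sum>j\<in>J. p j * (\<Sum>i\<in>I. inner (u i) (Y j i))) = 0"
    and var: "(\<Sum>j\<in>J. p j * (\<Sum>i\<in>I. inner (u i) (Y j i))\<^sup>2) \<le> v * (\<Sum>i\<in>I. (norm (u i))\<^sup>2)"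
    and v: "0 \<le> v"
  shows "(\<Sum>j\<in>J. p j * exp (\<theta> * smooth_norm I a (\<lambda>i. u i + Y j i)))
     \<le> exp (\<theta> * smooth_norm I a u) * exp (\<theta> * R\<^sup>2 / (2 * a) + 2 * \<theta>\<^sup>2 * (v + R^4 / (4 * a\<^sup>2)))"
proof -
  define f where "f = smooth_norm I a u"
  define c where "c j = (\<Sum>i\<in>I. inner (u i) (Y j i))" for j
  define h where "h = R\<^sup>2 / (2 * a)"
  define X where "X j = \<theta> * (c j / f + h)" for j
  have a: "0 < a" using R by linarith
  have fa: "a \<le> f" unfolding f_def using a by (intro smooth_norm_ge) simp
  have f0: "0 < f" using fa a by linarith
  have h0: "0 \<le> h" unfolding h_def using a by simp
  have hR: "h \<le> R / 2"
  proof -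
    have "R\<^sup>2 / (2 * a) \<le> R\<^sup>2 / (2 * R)" using R by (intro divide_left_mono) auto
    also have "\<dots> = R / 2" using R by (simp add: power2_eq_square)
    finally show ?thesis by (simp add: h_def)
  qed
  have cf: "\<bar>c j / f\<bar> \<le> R" if "j \<in> J" for j
  proof -
    have "\<bar>c j\<bar> \<le> (\<Sum>i\<in>I. \<bar>inner (u i) (Y j i)\<bar>)" unfolding c_def by (rule sum_abs)
    also have "\<dots> \<le> (\<Sum>i\<in>I. \<bar>norm (u i)\<bar> * \<bar>norm (Y j i)\<bar>)"
      by (intro sum_mono) (simp add: Cauchy_Schwarz_ineq2)
    also have "\<dots> \<le> L2_set (\<lambda>i. norm (u i)) I * L2_set (\<lambda>i. norm (Y j i)) I"
      by (rule L2_set_mult_ineq)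
    also have "\<dots> \<le> f * R"
    proof (intro mult_mono)
      show "L2_set (\<lambda>i. norm (u i)) I \<le> f"
        unfolding f_def using a by (intro smooth_norm_ge) simp
      show "L2_set (\<lambda>i. norm (Y j i)) I \<le> R"
        unfolding L2_set_def using bnd[OF that] R by (intro real_le_lsqrt) (auto simp: sum_nonneg)
    qed (use f0 in auto)
    finally show ?thesis using f0 by (simp add: abs_divide field_simps)
  qed
  have X1: "\<bar>X j\<bar> \<le> 1" if "j \<in> J" for j
  proof -
    \<comment> \<open>Cauchy-Schwarz contributes \<open>R\<close> and the drift
      \<open>R / 2\<close>. With \<open>\<theta> * R \<le> 1/2\<close> the exponent stays below 3/4,
      inside the range of the quadratic bound for \<open>exp\<close>.\<close>
    have "\<bar>c j / f + h\<bar> \<le> 3/2 * R" using cf[OF that] h0 hR by linarith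
    then have "\<theta> * \<bar>c j / f + h\<bar> \<le> \<theta> * (3/2 * R)" using \<theta>(1) by (rule mult_left_mono)
    also have "\<dots> \<le> 1" using \<theta> by simp
    finally show ?thesis unfolding X_def using \<theta>(1) by (simp add: abs_mult)
  qed
  have step: "exp (\<theta> * smooth_norm I a (\<lambda>i. u i + Y j i)) \<le> exp (\<theta> * f) * (1 + X j + (X j)\<^sup>2)"
    if "j \<in> J" for j
  proof -
    have "smooth_norm I a (\<lambda>i. u i + Y j i) \<le> f + c j / f + (\<Sum>i\<in>I. (norm (Y j i))\<^sup>2) / (2 * a)"
      unfolding f_def c_def by (rule smooth_norm_add_le[OF a])
    also have "\<dots> \<le> f + (c j / f + h)"
      unfolding h_def using bnd[OF that] a by (simp add: divide_right_mono)
    finally have "\<theta> * smooth_norm I a (\<lambda>i. u i + Y j i) \<le> \<theta> * f + X j"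
      using \<theta>(1) mult_left_mono unfolding X_def by (fastforce simp: distrib_left)
    then have "exp (\<theta> * smooth_norm I a (\<lambda>i. u i + Y j i)) \<le> exp (\<theta> * f) * exp (X j)"
      by (simp add: exp_add[symmetric])
    also have "\<dots> \<le> exp (\<theta> * f) * (1 + X j + (X j)\<^sup>2)"
      by (intro mult_left_mono exp_le_quadratic X1 that) simp
    finally show ?thesis .
  qed
  have m1: "(\<Sum>j\<in>J. p j * X j) = \<theta> * h"
  proof -
    have "(\<Sum>j\<in>J. p j * X j) = (\<Sum>j\<in>J. (\<theta> / f) * (p j * c j) + (\<theta> * h) * p j)"
      by (intro sum.cong) (auto simp: X_def field_simps)
    also have "\<dots> = (\<theta> / f) * (\<Sum>j\<in>J. p j * c j) + (\<theta> * h) * sum p J"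
      by (simp add: sum.distrib sum_distrib_left)
    finally show ?thesis using mean p1 by (simp add: c_def)
  qed
  have m2: "(\<Sum>j\<in>J. p j * (X j)\<^sup>2) \<le> 2 * \<theta>\<^sup>2 * (v + h\<^sup>2)"
  proof -
    have sq: "(x + y)\<^sup>2 \<le> 2 * x\<^sup>2 + 2 * y\<^sup>2" for x y :: real
      using sum_squares_bound[of x y] by (simp add: power2_sum)
    have "p j * (X j)\<^sup>2 \<le> (2 * \<theta>\<^sup>2 / f\<^sup>2) * (p j * (c j)\<^sup>2) + (2 * \<theta>\<^sup>2 * h\<^sup>2) * p j"
      if "j \<in> J" for j
    proof -
      have "(X j)\<^sup>2 \<le> \<theta>\<^sup>2 * (2 * (c j / f)\<^sup>2 + 2 * h\<^sup>2)"
        unfolding X_def power_mult_distrib by (intro mult_left_mono sq) simp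
      then have "p j * (X j)\<^sup>2 \<le> p j * (\<theta>\<^sup>2 * (2 * (c j / f)\<^sup>2 + 2 * h\<^sup>2))"
        using p0[OF that] by (rule mult_left_mono)
      then show ?thesis by (simp add: field_simps power_divide)
    qed
    then have "(\<Sum>j\<in>J. p j * (X j)\<^sup>2)
        \<le> (\<Sum>j\<in>J. (2 * \<theta>\<^sup>2 / f\<^sup>2) * (p j * (c j)\<^sup>2) + (2 * \<theta>\<^sup>2 * h\<^sup>2) * p j)"
      by (rule sum_mono)
    also have "\<dots> = (2 * \<theta>\<^sup>2 / f\<^sup>2) * (\<Sum>j\<in>J. p j * (c j)\<^sup>2) + 2 * \<theta>\<^sup>2 * h\<^sup>2"
      by (simp only: sum.distrib sum_distrib_left[symmetric] p1 mult_1_right)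
    also have "(2 * \<theta>\<^sup>2 / f\<^sup>2) * (\<Sum>j\<in>J. p j * (c j)\<^sup>2) \<le> (2 * \<theta>\<^sup>2 / f\<^sup>2) * (v * f\<^sup>2)"
    proof (intro mult_left_mono)
      have "f\<^sup>2 = a\<^sup>2 + (\<Sum>i\<in>I. (norm (u i))\<^sup>2)"
        unfolding f_def smooth_norm_def by (intro real_sqrt_pow2) (simp add: sum_nonneg)
      then have "v * (\<Sum>i\<in>I. (norm (u i))\<^sup>2) \<le> v * f\<^sup>2" using v by (intro mult_left_mono) auto
      then show "(\<Sum>j\<in>J. p j * (c j)\<^sup>2) \<le> v * f\<^sup>2" using var unfolding c_def by linarith
    qed simp
    also have "(2 * \<theta>\<^sup>2 / f\<^sup>2) * (v * f\<^sup>2) = 2 * \<theta>\<^sup>2 * v" using f0 by simp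
    finally show ?thesis by (simp add: distrib_left)
  qed
  have "(\<Sum>j\<in>J. p j * exp (\<theta> * smooth_norm I a (\<lambda>i. u i + Y j i)))
      \<le> (\<Sum>j\<in>J. p j * (exp (\<theta> * f) * (1 + X j + (X j)\<^sup>2)))"
    by (intro sum_mono mult_left_mono step p0)
  also have "\<dots> = exp (\<theta> * f) * (sum p J + (\<Sum>j\<in>J. p j * X j) + (\<Sum>j\<in>J. p j * (X j)\<^sup>2))"
    by (simp add: sum_distrib_left sum.distrib[symmetric] algebra_simps)
  also have "\<dots> \<le> exp (\<theta> * f) * (1 + (\<theta> * h + 2 * \<theta>\<^sup>2 * (v + h\<^sup>2)))"
    using m1 m2 p1 by (intro mult_left_mono) auto
  also have "\<dots> \<le> exp (\<theta> * f) * exp (\<theta> * h + 2 * \<theta>\<^sup>2 * (v + h\<^sup>2))"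
    by (intro mult_left_mono exp_ge_add_one_self) simp
  also have "h\<^sup>2 = R^4 / (4 * a\<^sup>2)" by (simp add: h_def power_divide power_mult_distrib)
  finally show ?thesis by (simp add: h_def f_def)
qed

text \<open>Derandomised vector Bernstein inequality: averaged over a sample, the potential summed over
  all blocks grows by at most the factor of the preceding lemma, so some sample does no worse.\<close>

lemma ex_small_block_sums:
  fixes Y :: "nat \<Rightarrow> 'j \<Rightarrow> 'i \<Rightarrow> 'a::real_inner"
  assumes fin: "finite J" and p0: "\<And>j. j \<in> J \<Longrightarrow> 0 \<le> p j" and p1: "sum p J = 1"
    and R: "0 < R" and \<theta>: "0 < \<theta>" "\<theta> * R \<le> 1/2" and L: "0 < L" and m: "0 < m"
    and bnd: "\<And>b j. b < m \<Longrightarrow> j \<in> J \<Longrightarrow> (\<Sum>i\<in>I. (norm (Y b j i))\<^sup>2) \<le> R\<^sup>2"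
    and mean: "\<And>b u. b < m \<Longrightarrow> (\<Sum>j\<in>J. p j * (\<Sum>i\<in>I. inner (u i) (Y b j i))) = 0"
    and var: "\<And>b u. b < m \<Longrightarrow> (\<Sum>j\<in>J. p j * (\<Sum>i\<in>I. inner (u i) (Y b j i))\<^sup>2)
        \<le> v * (\<Sum>i\<in>I. (norm (u i))\<^sup>2)"
    and v: "0 \<le> v"
  shows "\<exists>js. length js = L \<and> set js \<subseteq> J \<and>
     (\<forall>b<m. L2_set (\<lambda>i. norm (\<Sum>j\<leftarrow>js. Y b j i)) I
        \<le> ln (real m) / \<theta> + 3/2 * R * sqrt L + 2 * \<theta> * (L * v + R\<^sup>2 / 4))"
proof -
  \<comment> \<open>This choice balances the initial value \<open>a\<close> of the smooth norm
    against the drift \<open>L * R^2 / (2 a) = R sqrt L / 2\<close> of \<open>L\<close> steps;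
    together they give \<open>3/2 * R * sqrt L\<close>.\<close>
  define a where "a = R * sqrt L"
  have Ra: "R \<le> a" unfolding a_def using R L by simp
  have a: "0 < a" using R Ra by linarith
  define G where "G = \<theta> * R\<^sup>2 / (2 * a) + 2 * \<theta>\<^sup>2 * (v + R^4 / (4 * a\<^sup>2))"
  define \<Phi> where "\<Phi> js = (\<Sum>b<m. exp (\<theta> * smooth_norm I a (\<lambda>i. \<Sum>j\<leftarrow>js. Y b j i)))" for js
  have ex: "\<exists>js. length js = n \<and> set js \<subseteq> J \<and> \<Phi> js \<le> real m * exp (\<theta> * a + real n * G)" for n
  proof (induction n)
    case 0
    show ?case using a by (intro exI[of _ "[]"]) (simp add: \<Phi>_def smooth_norm_def)
  next
    case (Suc n)
    then obtain js where js: "length js = n" "set js \<subseteq> J"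
      "\<Phi> js \<le> real m * exp (\<theta> * a + real n * G)" by blast
    have "\<exists>j\<in>J. \<Phi> (j # js) \<le> \<Phi> js * exp G"
    proof (rule ccontr)
      assume "\<not> ?thesis"
      then have gt: "\<And>j. j \<in> J \<Longrightarrow> \<Phi> js * exp G < \<Phi> (j # js)" by force
      \<comment> \<open>A label of positive weight is what makes the averaged inequality below
        strict.\<close>
      have "\<exists>j\<in>J. 0 < p j"
      proof (rule ccontr)
        assume "\<not> (\<exists>j\<in>J. 0 < p j)"
        then have "sum p J \<le> 0" by (intro sum_nonpos) force
        then show False using p1 by simp
      qed
      then obtain j0 where j0: "j0 \<in> J" "0 < p j0" by blast
      have "\<Phi> js * exp G = (\<Sum>j\<in>J. p j * (\<Phi> js * exp G))"
        using p1 by (simp add: sum_distrib_right[symmetric])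
      also have "\<dots> < (\<Sum>j\<in>J. p j * \<Phi> (j # js))"
      proof (rule sum_strict_mono_ex1[OF fin])
        show "\<forall>j\<in>J. p j * (\<Phi> js * exp G) \<le> p j * \<Phi> (j # js)"
          using gt p0 by (intro ballI mult_left_mono) (auto intro: less_imp_le)
        show "\<exists>j\<in>J. p j * (\<Phi> js * exp G) < p j * \<Phi> (j # js)"
          using j0 gt by (intro bexI[of _ j0]) auto
      qed
      also have "\<dots> = (\<Sum>b<m. \<Sum>j\<in>J. p j *
          exp (\<theta> * smooth_norm I a (\<lambda>i. (\<Sum>j\<leftarrow>js. Y b j i) + Y b j i)))"
        unfolding \<Phi>_def sum_distrib_left
        by (subst sum.swap) (simp add: add.commute)
      also have "\<dots> \<le> (\<Sum>b<m. exp (\<theta> * smooth_norm I a (\<lambda>i. \<Sum>j\<leftarrow>js. Y b j i)) * exp G)"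
        unfolding G_def
      proof (intro sum_mono smooth_norm_exp_step)
        fix b assume "b \<in> {..<m}"
        then have b: "b < m" by simp
        show "(\<Sum>j\<in>J. p j * (\<Sum>i\<in>I. inner (\<Sum>j\<leftarrow>js. Y b j i) (Y b j i))) = 0"
          by (rule mean[OF b])
        show "(\<Sum>j\<in>J. p j * (\<Sum>i\<in>I. inner (\<Sum>j\<leftarrow>js. Y b j i) (Y b j i))\<^sup>2)
          \<le> v * (\<Sum>i\<in>I. (norm (\<Sum>j\<leftarrow>js. Y b j i))\<^sup>2)"
          by (rule var[OF b])
      qed (use p0 p1 R Ra \<theta> v bnd in auto)
      also have "\<dots> = \<Phi> js * exp G" by (simp add: \<Phi>_def sum_distrib_right)
      finally show False by simp
    qed
    then obtain j where j: "j \<in> J" "\<Phi> (j # js) \<le> \<Phi> js * exp G" by blast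
    have "\<Phi> js * exp G \<le> real m * exp (\<theta> * a + real n * G) * exp G"
      by (intro mult_right_mono js) simp
    also have "\<dots> = real m * exp (\<theta> * a + real (Suc n) * G)"
      by (simp add: mult_exp_exp algebra_simps)
    finally show ?case using j js by (intro exI[of _ "j # js"]) auto
  qed
  obtain js where js: "length js = L" "set js \<subseteq> J"
      "\<Phi> js \<le> real m * exp (\<theta> * a + real L * G)" using ex by blast
  have "L2_set (\<lambda>i. norm (\<Sum>j\<leftarrow>js. Y b j i)) I
        \<le> ln (real m) / \<theta> + 3/2 * R * sqrt L + 2 * \<theta> * (L * v + R\<^sup>2 / 4)" if b: "b < m" for b
  proof -
    let ?s = "smooth_norm I a (\<lambda>i. \<Sum>j\<leftarrow>js. Y b j i)"
    \<comment> \<open>A single block is dominated by the whole potential. After taking logarithms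
      the union over the blocks costs only the additive term \<open>ln m / \<theta>\<close>.\<close>
    have "exp (\<theta> * ?s) \<le> \<Phi> js"
      unfolding \<Phi>_def using b by (intro member_le_sum) auto
    also have "\<dots> \<le> exp (ln (real m) + (\<theta> * a + real L * G))" using js m by (simp add: exp_add)
    finally have "\<theta> * ?s \<le> ln (real m) + (\<theta> * a + real L * G)" by simp
    also have "real L * G = \<theta> * (R * sqrt L / 2) + \<theta> * (2 * \<theta> * (L * v + R\<^sup>2 / 4))"
    proof -
      have s: "sqrt L * sqrt L = L" by simp
      have 1: "real L * (\<theta> * R\<^sup>2 / (2 * a)) = \<theta> * (R * sqrt L / 2)"
        unfolding a_def using R L by (simp add: field_simps power2_eq_square)
      have 2: "real L * (R^4 / (4 * a\<^sup>2)) = R\<^sup>2 / 4"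
        unfolding a_def using R L
        by (simp add: power_mult_distrib field_simps power2_eq_square power4_eq_xxxx)
      have "real L * (2 * \<theta>\<^sup>2 * (v + q)) = \<theta> * (2 * \<theta> * (L * v + L * q))" for q :: real
        by (simp add: algebra_simps power2_eq_square)
      then show ?thesis unfolding G_def distrib_left[of "real L"] 1 by (simp only: 2)
    qed
    finally have "\<theta> * ?s \<le> \<theta> * (ln (real m) / \<theta> + a + R * sqrt L / 2 + 2 * \<theta> * (L * v + R\<^sup>2 / 4))"
      using \<theta>(1) by (simp add: distrib_left)
    then have "?s \<le> ln (real m) / \<theta> + a + R * sqrt L / 2 + 2 * \<theta> * (L * v + R\<^sup>2 / 4)"
      using \<theta>(1) by simp
    moreover have "L2_set (\<lambda>i. norm (\<Sum>j\<leftarrow>js. Y b j i)) I \<le> ?s"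
      using a by (intro smooth_norm_ge) simp
    ultimately show ?thesis by (simp add: a_def)
  qed
  with js show ?thesis by blast
qed

subsection \<open>Maurey's empirical method\<close>

text \<open>Duality: \<open>cnj (g j)\<close> are the coordinates of the adjoint applied to
  \<open>u\<close>. Testing \<open>op\<close> on this very vector gives
  \<open>W \<le> |u| * s * sqrt W\<close>, and one factor \<open>sqrt W\<close> cancels.\<close>

lemma weak_variance_le:
  fixes a :: "'i \<Rightarrow> 'j \<Rightarrow> complex" and u :: "'i \<Rightarrow> complex"
  assumes s: "0 \<le> s"
    and op: "\<And>y. L2_set (\<lambda>i. cmod (\<Sum>j\<in>S. a i j * y j)) I \<le> s * L2_set (\<lambda>j. cmod (y j)) S"
  shows "(\<Sum>j\<in>S. (cmod (\<Sum>i\<in>I. cnj (u i) * a i j))\<^sup>2) \<le> s\<^sup>2 * (\<Sum>i\<in>I. (cmod (u i))\<^sup>2)"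
proof -
  define g where "g j = (\<Sum>i\<in>I. cnj (u i) * a i j)" for j
  define W where "W = (\<Sum>j\<in>S. (cmod (g j))\<^sup>2)"
  have W0: "0 \<le> W" unfolding W_def by (intro sum_nonneg) simp
  have "complex_of_real W = (\<Sum>j\<in>S. g j * cnj (g j))"
    unfolding W_def by (simp add: complex_norm_square del: of_real_power)
  also have "\<dots> = (\<Sum>j\<in>S. \<Sum>i\<in>I. cnj (u i) * (a i j * cnj (g j)))"
    by (subst (1) g_def) (simp add: sum_distrib_right mult.assoc)
  also have "\<dots> = (\<Sum>i\<in>I. cnj (u i) * (\<Sum>j\<in>S. a i j * cnj (g j)))"
    by (subst sum.swap) (simp add: sum_distrib_left)
  finally have eq: "complex_of_real W = (\<Sum>i\<in>I. cnj (u i) * (\<Sum>j\<in>S. a i j * cnj (g j)))" .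
  have "W = cmod (complex_of_real W)" using W0 by simp
  also have "\<dots> \<le> (\<Sum>i\<in>I. cmod (cnj (u i) * (\<Sum>j\<in>S. a i j * cnj (g j))))"
    unfolding eq by (rule norm_sum)
  also have "\<dots> = (\<Sum>i\<in>I. \<bar>cmod (u i)\<bar> * \<bar>cmod (\<Sum>j\<in>S. a i j * cnj (g j))\<bar>)"
    by (simp add: norm_mult)
  also have "\<dots> \<le> L2_set (\<lambda>i. cmod (u i)) I * L2_set (\<lambda>i. cmod (\<Sum>j\<in>S. a i j * cnj (g j))) I"
    by (rule L2_set_mult_ineq)
  also have "\<dots> \<le> L2_set (\<lambda>i. cmod (u i)) I * (s * L2_set (\<lambda>j. cmod (cnj (g j))) S)"
    by (intro mult_left_mono op) simp
  also have "L2_set (\<lambda>j. cmod (cnj (g j))) S = sqrt W" by (simp add: L2_set_def W_def)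
  finally have "sqrt W * sqrt W \<le> (s * L2_set (\<lambda>i. cmod (u i)) I) * sqrt W"
    using W0 by (simp add: mult_ac)
  then have "sqrt W \<le> s * L2_set (\<lambda>i. cmod (u i)) I"
  proof (cases "W = 0")
    case False
    then have "0 < sqrt W" using W0 by simp
    with \<open>sqrt W * sqrt W \<le> _\<close> show ?thesis by (rule mult_right_le_imp_le)
  qed (use s in simp)
  then have "(sqrt W)\<^sup>2 \<le> (s * L2_set (\<lambda>i. cmod (u i)) I)\<^sup>2"
    using W0 by (intro power_mono) auto
  then have "W \<le> s\<^sup>2 * (\<Sum>i\<in>I. (cmod (u i))\<^sup>2)"
    using W0 by (simp add: power_mult_distrib L2_set_def sum_nonneg)
  then show ?thesis by (simp add: W_def g_def)
qed

lemma sum_cmod_le: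
  assumes "finite S" "card S \<le> k" "(\<Sum>j\<in>S. (cmod (x j))\<^sup>2) \<le> 1"
  shows "(\<Sum>j\<in>S. cmod (x j)) \<le> sqrt (real k)"
proof -
  have "(\<Sum>j\<in>S. \<bar>1\<bar> * \<bar>cmod (x j)\<bar>) \<le> L2_set (\<lambda>_. 1) S * L2_set (\<lambda>j. cmod (x j)) S"
    by (rule L2_set_mult_ineq)
  also have "\<dots> \<le> L2_set (\<lambda>_. 1) S * 1"
    using assms(3) by (intro mult_left_mono) (auto simp: L2_set_def)
  also have "\<dots> \<le> sqrt (real k)" using assms(2) by (simp add: L2_set_def)
  finally show ?thesis by simp
qed

section \<open>Random rounding of the unit disc to four points\<close>

definition corners :: "complex set" where
  "corners = {Complex 1 1, Complex 1 (- 1), Complex (- 1) 1, Complex (- 1) (- 1)}"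

text \<open>The joint law of two independent random signs with means \<open>Re w\<close> and
  \<open>Im w\<close>. It writes every point of the unit disc as the mean of a random vertex of the
  square around the disc.\<close>

definition corner_weight :: "complex \<Rightarrow> complex \<Rightarrow> real" where
  "corner_weight w \<omega> = (1 + Re \<omega> * Re w) * (1 + Im \<omega> * Im w) / 4"

lemma finite_corners: "finite corners"
  by (simp add: corners_def)

lemma card_corners: "card corners = 4"
  by (simp add: corners_def)

lemma norm_corner:
  assumes "\<omega> \<in> corners"
  shows "(cmod \<omega>)\<^sup>2 = 2"
  using assms by (auto simp: corners_def cmod_power2)

lemma corner_weight_nonneg:
  assumes "\<omega> \<in> corners" "cmod w \<le> 1"
  shows "0 \<le> corner_weight w \<omega>"
proof -
  have "\<bar>Re w\<bar> \<le> 1" "\<bar>Im w\<bar> \<le> 1"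
    using assms(2) abs_Re_le_cmod[of w] abs_Im_le_cmod[of w] by linarith+
  then show ?thesis
    using assms(1) by (auto simp: corners_def corner_weight_def intro!: mult_nonneg_nonneg)
qed

lemma sum_corner_weight: "(\<Sum>\<omega>\<in>corners. corner_weight w \<omega>) = 1"
  by (simp add: corners_def corner_weight_def field_simps)

lemma corner_barycentre: "(\<Sum>\<omega>\<in>corners. corner_weight w \<omega> *\<^sub>R \<omega>) = w"
  by (simp add: corners_def corner_weight_def complex_eq_iff field_simps)

text \<open>The least admissible exponent works: if it is positive, its predecessor fails. Rounding
  sizes up to powers of two in this way leaves few sizes to encode.\<close>

lemma ex_dyadic_level:
  fixes r :: real
  shows "\<exists>h. r \<le> 2 ^ h \<and> 2 ^ h \<le> max 1 (2 * r)"
proof -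
  obtain n where n: "r < 2 ^ n" using real_arch_pow[of 2 r] by auto
  define h where "h = (LEAST h. r \<le> 2 ^ h)"
  have h: "r \<le> 2 ^ h" unfolding h_def by (rule LeastI[of _ n]) (use n in simp)
  have "2 ^ h \<le> max 1 (2 * r)"
  proof (cases h)
    case (Suc l)
    then have "\<not> r \<le> 2 ^ l" unfolding h_def by (intro not_less_Least) simp
    then show ?thesis using Suc by simp
  qed simp
  then show ?thesis using h by blast
qed

lemma weighted_variance_le:
  fixes c p :: "'j \<Rightarrow> real"
  assumes "sum p J = 1" "(\<Sum>j\<in>J. p j * c j) = \<mu>"
  shows "(\<Sum>j\<in>J. p j * (c j - \<mu>)\<^sup>2) \<le> (\<Sum>j\<in>J. p j * (c j)\<^sup>2)"
proof -
  have "(\<Sum>j\<in>J. p j * (c j - \<mu>)\<^sup>2)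
      = (\<Sum>j\<in>J. p j * (c j)\<^sup>2 - (2 * \<mu>) * (p j * c j) + \<mu>\<^sup>2 * p j)"
    by (intro sum.cong) (auto simp: power2_eq_square algebra_simps)
  also have "\<dots> = (\<Sum>j\<in>J. p j * (c j)\<^sup>2) - (2 * \<mu>) * (\<Sum>j\<in>J. p j * c j) + \<mu>\<^sup>2 * sum p J"
    by (simp only: sum.distrib sum_subtractf sum_distrib_left)
  also have "\<dots> = (\<Sum>j\<in>J. p j * (c j)\<^sup>2) - \<mu>\<^sup>2"
    using assms by (simp add: power2_eq_square)
  finally show ?thesis by simp
qed

text \<open>Maurey's empirical method.  The sampling weights \<open>p j\<close> mix \<open>1 / card S\<close> with \<open>|x j|^2\<close>:
  the first keeps the jumps \<open>x j / p j\<close> below \<open>sqrt (card S)\<close>, both together keep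
  \<open>|x j|^2 / p j\<close> bounded, so that the weak variance is controlled by the operator norm on \<open>S\<close>.
  Each jump is replaced by a corner of a square of dyadic size \<open>2 ^ h j\<close>, so that only
  polynomially many (in \<open>d\<close>) different jumps occur.\<close>

lemma ex_maurey_labels:
  fixes a :: "nat \<Rightarrow> nat \<Rightarrow> nat \<Rightarrow> complex" and x :: "nat \<Rightarrow> complex"
  assumes S: "S \<subseteq> {..<d}" "S \<noteq> {}" "card S \<le> k"
    and x: "(\<Sum>j\<in>S. (cmod (x j))\<^sup>2) \<le> 1"
    and entries: "\<And>b i j. b < m \<Longrightarrow> i < B \<Longrightarrow> j < d \<Longrightarrow> cmod (a b i j) \<le> 1"
    and op: "\<And>b y. b < m \<Longrightarrow> L2_set (\<lambda>i. cmod (\<Sum>j\<in>S. a b i j * y j)) {..<B}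
        \<le> s * L2_set (\<lambda>j. cmod (y j)) S"
    and s: "0 \<le> s" and M: "1 \<le> M" "ln (real m) \<le> M" "M * s \<le> 2 * sqrt (real k * real B)"
    and L: "M\<^sup>2 \<le> real L" and m: "0 < m" and B: "0 < B"
  shows "\<exists>ls. length ls = L \<and> set ls \<subseteq> {..<d} \<times> {..d} \<times> corners \<and>
    (\<forall>b<m. L2_set (\<lambda>i. cmod ((\<Sum>(j,h,\<omega>)\<leftarrow>ls. 2 ^ h * \<omega> * a b i j)
        - of_nat L * (\<Sum>j\<in>S. a b i j * x j))) {..<B} \<le> 32 * sqrt (real k * real B * real L))"
proof -
  define \<kappa> where "\<kappa> = real (card S)"
  have finS: "finite S" using S(1) finite_subset by blast
  have kap1: "1 \<le> \<kappa>" unfolding \<kappa>_def using finS S(2) by (simp add: Suc_le_eq card_gt_0_iff)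
  have kapk: "\<kappa> \<le> real k" unfolding \<kappa>_def using S(3) by simp
  have k0: "0 < real k" using kap1 kapk by linarith
  have kapd: "\<kappa> \<le> real d" unfolding \<kappa>_def using card_mono[OF _ S(1)] by simp
  define X where "X = (\<Sum>j\<in>S. (cmod (x j))\<^sup>2)"
  have X: "0 \<le> X" "X \<le> 1" using x by (auto simp: X_def sum_nonneg)
  \<comment> \<open>The numerator \<open>2 - X\<close>, instead of 1, makes the weights add up to 1
    also when \<open>X < 1\<close>.\<close>
  define p where "p j = (2 - X) / (2 * \<kappa>) + (cmod (x j))\<^sup>2 / 2" for j
  have p_ge: "1 / (2 * \<kappa>) \<le> (2 - X) / (2 * \<kappa>)" using X kap1 by (intro divide_right_mono) auto
  have p_ge1: "1 / (2 * \<kappa>) + (cmod (x j))\<^sup>2 / 2 \<le> p j" for j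
    unfolding p_def using p_ge by simp
  have p_pos: "0 < p j" for j
  proof -
    have "0 < 1 / (2 * \<kappa>) + (cmod (x j))\<^sup>2 / 2" using kap1 by (intro add_pos_nonneg) auto
    then show ?thesis using p_ge1[of j] by linarith
  qed
  have p_sum: "sum p S = 1"
  proof -
    have "sum p S = \<kappa> * ((2 - X) / (2 * \<kappa>)) + X / 2"
      unfolding p_def X_def \<kappa>_def by (simp add: sum.distrib sum_divide_distrib)
    then show ?thesis using kap1 by (simp add: field_simps)
  qed
  have p_le1: "p j \<le> 1" if "j \<in> S" for j
    using member_le_sum[of j S p] p_pos that finS p_sum by (auto intro: less_imp_le)
  have am: "u * v \<le> (u\<^sup>2 + v\<^sup>2) / 2" for u v :: real
    using sum_squares_bound[of u v] by simp
  \<comment> \<open>By the arithmetic-geometric mean inequality,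
    \<open>|x j| / sqrt \<kappa>\<close> is at most half of \<open>|x j|^2 + 1 / \<kappa>\<close>,
    and this is below \<open>p j\<close>.\<close>
  have jump: "cmod (x j) / p j \<le> sqrt \<kappa>" for j
  proof -
    have "cmod (x j) = sqrt \<kappa> * (cmod (x j) * (1 / sqrt \<kappa>))" using kap1 by simp
    also have "\<dots> \<le> sqrt \<kappa> * (((cmod (x j))\<^sup>2 + (1 / sqrt \<kappa>)\<^sup>2) / 2)"
    proof (intro mult_left_mono)
      show "cmod (x j) * (1 / sqrt \<kappa>) \<le> ((cmod (x j))\<^sup>2 + (1 / sqrt \<kappa>)\<^sup>2) / 2"
        by (rule am)
    qed (use kap1 in simp)
    also have "\<dots> \<le> sqrt \<kappa> * p j"
      using p_ge1[of j] kap1 by (intro mult_left_mono) (auto simp: power_divide add_divide_distrib)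
    finally show ?thesis using p_pos[of j] by (simp add: divide_le_eq)
  qed
  have "\<forall>j. \<exists>h. cmod (x j) / p j \<le> 2 ^ h \<and> 2 ^ h \<le> max 1 (2 * (cmod (x j) / p j))"
    using ex_dyadic_level by blast
  then obtain h where h: "\<And>j. cmod (x j) / p j \<le> 2 ^ h j"
      "\<And>j. 2 ^ h j \<le> max 1 (2 * (cmod (x j) / p j))" by metis
  have h_le: "2 ^ h j \<le> 2 * sqrt \<kappa>" for j
  proof -
    have "1 \<le> sqrt \<kappa>" using kap1 by simp
    then show ?thesis using h(2)[of j] jump[of j] by linarith
  qed
  have d: "d \<noteq> 0" using kap1 kapd by auto
  \<comment> \<open>From \<open>2 ^ h \<le> 2 d \<le> 2 ^ d\<close>. This confines the exponents to
    at most \<open>d + 1\<close> values, so that the label set is polynomial in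
    \<open>d\<close>.\<close>
  have h_d: "h j \<le> d" for j
  proof -
    have "sqrt \<kappa> \<le> sqrt ((real d)\<^sup>2)"
      using kapd d by (intro real_sqrt_le_mono) (simp add: power2_eq_square order_trans[OF kapd])
    then have "(2::real) ^ h j \<le> 2 * real d" using h_le[of j] by simp
    also have "2 * real d \<le> 2 ^ d"
    proof -
      obtain e where e: "d = Suc e" using d not0_implies_Suc by blast
      have "Suc e \<le> 2 ^ e" using less_exp[of e] by (rule Suc_leI)
      then have "real (Suc e) \<le> 2 ^ e" by (metis of_nat_le_iff of_nat_numeral of_nat_power)
      then show ?thesis unfolding e by simp
    qed
    finally show ?thesis by simp
  qed
  \<comment> \<open>Small jumps are rounded to size 1, where \<open>p j \<le> 1\<close> suffices.
    For the others rounding at most doubles the jump, and the part \<open>|x j|^2 / 2\<close> of the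
    weight gives \<open>4 |x j|^2 / p j \<le> 8\<close>.\<close>
  have h_sq: "p j * (2 ^ h j)\<^sup>2 \<le> 8" if j: "j \<in> S" for j
  proof (cases "2 * (cmod (x j) / p j) \<le> 1")
    case True
    then have "(2::real) ^ h j \<le> 1" using h(2)[of j] by simp
    then have "((2::real) ^ h j)\<^sup>2 \<le> 1\<^sup>2" by (rule power_mono) simp
    then have "p j * (2 ^ h j)\<^sup>2 \<le> 1 * 1\<^sup>2"
      by (intro mult_mono p_le1[OF j]) auto
    then show ?thesis by simp
  next
    case False
    then have "(2::real) ^ h j \<le> 2 * (cmod (x j) / p j)" using h(2)[of j] by simp
    then have "((2::real) ^ h j)\<^sup>2 \<le> (2 * (cmod (x j) / p j))\<^sup>2" by (intro power_mono) auto
    then have "p j * (2 ^ h j)\<^sup>2 \<le> p j * (2 * (cmod (x j) / p j))\<^sup>2"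
      using p_pos[of j] by (intro mult_left_mono) auto
    also have "\<dots> = 4 * (cmod (x j))\<^sup>2 / p j"
      using p_pos[of j] by (simp add: power2_eq_square)
    also have "\<dots> \<le> 8"
    proof -
      have "0 \<le> 1 / (2 * \<kappa>)" using kap1 by simp
      then have "(cmod (x j))\<^sup>2 / 2 \<le> p j" using p_ge1[of j] by linarith
      then show ?thesis using p_pos[of j] by (simp add: divide_le_eq)
    qed
    finally show ?thesis .
  qed
  \<comment> \<open>The jump \<open>x j / p j\<close> divided by its dyadic size. A random corner
    with mean \<open>w j\<close>, scaled back by \<open>2 ^ h j\<close>, has the jump as its mean,
    so the samples \<open>T\<close> are unbiased for \<open>z\<close>.\<close>
  define w where "w j = x j / of_real (p j * 2 ^ h j)" for j
  have w1: "cmod (w j) \<le> 1" for j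
    using h(1)[of j] p_pos[of j] by (simp add: w_def norm_divide norm_mult norm_power divide_le_eq mult.commute)
  define J where "J = S \<times> corners"
  define P where "P = (\<lambda>(j, \<omega>). p j * corner_weight (w j) \<omega>)"
  define T where "T = (\<lambda>b (j, \<omega>) i. 2 ^ h j * \<omega> * a b i j)"
  define z where "z b i = (\<Sum>j\<in>S. a b i j * x j)" for b i
  have finJ: "finite J" unfolding J_def using finS finite_corners by simp
  have P0: "0 \<le> P q" if "q \<in> J" for q
    using that p_pos w1 corner_weight_nonneg unfolding J_def P_def
    by (auto intro!: mult_nonneg_nonneg intro: less_imp_le)
  have P1: "sum P J = 1"
    unfolding J_def P_def
    by (simp add: sum.cartesian_product[symmetric] sum_distrib_left[symmetric] sum_corner_weight p_sum)
  have PT: "(\<Sum>q\<in>J. P q *\<^sub>R T b q i) = z b i" for b i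
  proof -
    have "(\<Sum>q\<in>J. P q *\<^sub>R T b q i)
       = (\<Sum>j\<in>S. (p j *\<^sub>R (2 ^ h j * a b i j)) * (\<Sum>\<omega>\<in>corners. corner_weight (w j) \<omega> *\<^sub>R \<omega>))"
      unfolding J_def P_def T_def sum_distrib_left sum.cartesian_product
      by (intro sum.cong) (auto simp: scaleR_conv_of_real mult_ac)
    also have "\<dots> = z b i"
      unfolding corner_barycentre z_def
    proof (intro sum.cong refl)
      fix j
      have "complex_of_real (p j) \<noteq> 0" using p_pos[of j] by simp
      then show "(p j *\<^sub>R (2 ^ h j * a b i j)) * w j = a b i j * x j"
        by (simp add: w_def scaleR_conv_of_real field_simps)
    qed
    finally show ?thesis .
  qed
  define r where "r = sqrt (real k * real B)"
  have r0: "0 < r" unfolding r_def using k0 B by simp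
  have L0: "0 < L"
  proof -
    have "1 \<le> M\<^sup>2" using M(1) by simp
    then show ?thesis using L by (cases L) auto
  qed
  have sL: "1 \<le> sqrt L" using L0 by simp
  have M_le: "M \<le> sqrt L" using L by (simp add: real_le_rsqrt)
  \<comment> \<open>Since \<open>ln m \<le> M\<close>, the cost \<open>ln m / \<theta>\<close> of
    the blocks is at most \<open>8 r sqrt L\<close>; since \<open>M \<le> sqrt L\<close>, the
    smallness condition \<open>\<theta> * (4 r) \<le> 1/2\<close> holds.\<close>
  define \<theta> where "\<theta> = M / (8 * r * sqrt L)"
  have th0: "0 < \<theta>" unfolding \<theta>_def using M r0 sL by simp
  have "\<exists>js. length js = L \<and> set js \<subseteq> J \<and>
     (\<forall>b<m. L2_set (\<lambda>i. norm (\<Sum>q\<leftarrow>js. T b q i - z b i)) {..<B}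
        \<le> ln (real m) / \<theta> + 3/2 * (4 * r) * sqrt L + 2 * \<theta> * (L * (16 * s\<^sup>2) + (4 * r)\<^sup>2 / 4))"
  proof (rule ex_small_block_sums[OF finJ P0 P1])
    show "\<theta> * (4 * r) \<le> 1/2" unfolding \<theta>_def using M_le r0 sL by (simp add: field_simps)
  next
    fix b q assume b: "b < m" and q: "q \<in> J"
    obtain j \<omega> where q': "q = (j, \<omega>)" "j \<in> S" "\<omega> \<in> corners" using q by (auto simp: J_def)
    have jd: "j < d" using q' S(1) by auto
    have \<omega>: "cmod \<omega> \<le> 3/2"
    proof -
      have "(cmod \<omega>)\<^sup>2 \<le> (3/2)\<^sup>2" unfolding norm_corner[OF q'(3)] by (simp add: power2_eq_square)
      then show ?thesis by (rule power2_le_imp_le) simp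
    qed
    have xs: "(\<Sum>j\<in>S. cmod (x j)) \<le> sqrt \<kappa>"
      unfolding \<kappa>_def by (rule sum_cmod_le[OF finS order_refl x])
    have "norm (T b q i - z b i) \<le> 4 * sqrt \<kappa>" if i: "i < B" for i
    proof -
      have "cmod (T b q i) = 2 ^ h j * cmod \<omega> * cmod (a b i j)"
        by (simp add: T_def q' norm_mult norm_power)
      \<comment> \<open>The factors bound the dyadic size, the corner modulus \<open>sqrt 2\<close>
        and the matrix entry. Adding \<open>sqrt \<kappa>\<close> for the mean gives
        \<open>4 * sqrt \<kappa>\<close> per row, hence the radius \<open>4 * r\<close>.\<close>
      also have "\<dots> \<le> (2 * sqrt \<kappa>) * (3/2) * 1"
        using h_le[of j] \<omega> entries[OF b i jd] kap1 by (intro mult_mono) auto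
      finally have 1: "cmod (T b q i) \<le> 3 * sqrt \<kappa>" by simp
      have "cmod (z b i) \<le> (\<Sum>j\<in>S. cmod (a b i j) * cmod (x j))"
        unfolding z_def by (rule order_trans[OF norm_sum]) (simp add: norm_mult)
      also have "\<dots> \<le> (\<Sum>j\<in>S. 1 * cmod (x j))"
        using entries[OF b i] S(1) by (intro sum_mono mult_right_mono) auto
      finally have "cmod (z b i) \<le> sqrt \<kappa>" using xs by simp
      then show ?thesis using 1 norm_triangle_ineq4[of "T b q i" "z b i"] by linarith
    qed
    then have "(\<Sum>i<B. (norm (T b q i - z b i))\<^sup>2) \<le> (\<Sum>i<B. (4 * sqrt \<kappa>)\<^sup>2)"
      by (intro sum_mono power_mono) auto
    also have "\<dots> = 16 * (real B * \<kappa>)" using kap1 by (simp add: power_mult_distrib)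
    also have "\<dots> \<le> 16 * (real B * real k)" using kapk by (intro mult_left_mono) auto
    also have "\<dots> = (4 * r)\<^sup>2" by (simp add: r_def power_mult_distrib)
    finally show "(\<Sum>i<B. (norm (T b q i - z b i))\<^sup>2) \<le> (4 * r)\<^sup>2" .
  next
    fix b and u :: "nat \<Rightarrow> complex" assume b: "b < m"
    define c where "c q = (\<Sum>i<B. inner (u i) (T b q i))" for q
    define \<mu> where "\<mu> = (\<Sum>i<B. inner (u i) (z b i))"
    define g where "g j = (\<Sum>i<B. cnj (u i) * a b i j)" for j
    have cmu: "(\<Sum>i<B. inner (u i) (T b q i - z b i)) = c q - \<mu>" for q
      by (simp add: c_def \<mu>_def inner_diff_right sum_subtractf)
    have Pc: "(\<Sum>q\<in>J. P q * c q) = \<mu>"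
    proof -
      have "(\<Sum>q\<in>J. P q * c q) = (\<Sum>i<B. inner (u i) (\<Sum>q\<in>J. P q *\<^sub>R T b q i))"
        unfolding c_def sum_distrib_left inner_sum_right inner_scaleR_right by (rule sum.swap)
      then show ?thesis by (simp add: PT \<mu>_def)
    qed
    have "(\<Sum>q\<in>J. P q * (c q - \<mu>)) = (\<Sum>q\<in>J. P q * c q) - sum P J * \<mu>"
      by (simp only: right_diff_distrib sum_subtractf sum_distrib_right)
    then show "(\<Sum>q\<in>J. P q * (\<Sum>i<B. inner (u i) (T b q i - z b i))) = 0"
      unfolding cmu using Pc P1 by simp
    \<comment> \<open>The real inner product is the real part of the complex pairing, so the real
      weak variance is governed by the complex numbers \<open>g j\<close>.\<close>
    have cRe: "c (j, \<omega>) = Re (2 ^ h j * \<omega> * g j)" for j \<omega>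
      unfolding c_def T_def g_def sum_distrib_left Re_sum
      by (intro sum.cong) (auto simp: inner_complex_def algebra_simps)
    have cg: "(c (j, \<omega>))\<^sup>2 \<le> 2 * (2 ^ h j)\<^sup>2 * (cmod (g j))\<^sup>2" if "\<omega> \<in> corners" for j \<omega>
    proof -
      have "\<bar>Re (2 ^ h j * \<omega> * g j)\<bar>\<^sup>2 \<le> (cmod (2 ^ h j * \<omega> * g j))\<^sup>2"
        by (intro power_mono abs_Re_le_cmod) simp
      also have "\<dots> = (2 ^ h j)\<^sup>2 * (cmod \<omega>)\<^sup>2 * (cmod (g j))\<^sup>2"
        by (simp add: norm_mult norm_power power_mult_distrib)
      finally show ?thesis using norm_corner[OF that] by (simp add: cRe mult_ac)
    qed
    have "(\<Sum>q\<in>J. P q * (c q - \<mu>)\<^sup>2) \<le> (\<Sum>q\<in>J. P q * (c q)\<^sup>2)"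
      by (rule weighted_variance_le[OF P1 Pc])
    also have "\<dots> = (\<Sum>j\<in>S. \<Sum>\<omega>\<in>corners. P (j, \<omega>) * (c (j, \<omega>))\<^sup>2)"
      unfolding J_def by (simp add: sum.cartesian_product)
    also have "\<dots> \<le> (\<Sum>j\<in>S. \<Sum>\<omega>\<in>corners. P (j, \<omega>) * (2 * (2 ^ h j)\<^sup>2 * (cmod (g j))\<^sup>2))"
      using P0 cg by (intro sum_mono mult_left_mono) (auto simp: J_def)
    also have "\<dots> = (\<Sum>j\<in>S. 2 * (p j * (2 ^ h j)\<^sup>2) * (cmod (g j))\<^sup>2 *
        (\<Sum>\<omega>\<in>corners. corner_weight (w j) \<omega>))"
      unfolding P_def sum_distrib_left by (intro sum.cong) (auto simp: mult_ac)
    \<comment> \<open>Here 2 is the squared modulus of a corner and 8 the bound on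
      \<open>p j * (2 ^ h j)^2\<close>; their product is the constant 16 of the weak
      variance.\<close>
    also have "\<dots> \<le> (\<Sum>j\<in>S. 2 * 8 * (cmod (g j))\<^sup>2)"
      unfolding sum_corner_weight using h_sq by (intro sum_mono) (simp add: mult_right_mono)
    also have "\<dots> = 16 * (\<Sum>j\<in>S. (cmod (g j))\<^sup>2)" by (simp add: sum_distrib_left)
    also have "\<dots> \<le> 16 * (s\<^sup>2 * (\<Sum>i<B. (cmod (u i))\<^sup>2))"
      unfolding g_def by (intro mult_left_mono weak_variance_le s op[OF b]) simp
    finally show "(\<Sum>q\<in>J. P q * (\<Sum>i<B. inner (u i) (T b q i - z b i))\<^sup>2)
        \<le> 16 * s\<^sup>2 * (\<Sum>i<B. (norm (u i))\<^sup>2)"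
      unfolding cmu by simp
  qed (use r0 th0 L0 m s in auto)
  then obtain js where js: "length js = L" "set js \<subseteq> J"
    "\<And>b. b < m \<Longrightarrow> L2_set (\<lambda>i. norm (\<Sum>q\<leftarrow>js. T b q i - z b i)) {..<B}
        \<le> ln (real m) / \<theta> + 3/2 * (4 * r) * sqrt L + 2 * \<theta> * (L * (16 * s\<^sup>2) + (4 * r)\<^sup>2 / 4)"
    by blast
  have bound: "ln (real m) / \<theta> + 3/2 * (4 * r) * sqrt L + 2 * \<theta> * (L * (16 * s\<^sup>2) + (4 * r)\<^sup>2 / 4)
      \<le> 32 * (r * sqrt L)"
  proof -
    have 1: "ln (real m) / \<theta> \<le> 8 * (r * sqrt L)"
    proof -
      have "ln (real m) / \<theta> \<le> M / \<theta>" using M th0 by (intro divide_right_mono) auto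
      also have "\<dots> = 8 * (r * sqrt L)" unfolding \<theta>_def using M r0 sL by simp
      finally show ?thesis .
    qed
    have 2: "2 * \<theta> * (L * (16 * s\<^sup>2)) \<le> 16 * (r * sqrt L)"
    proof -
      \<comment> \<open>The assumption controls \<open>M * s\<close>, while the variance term
        contains \<open>M * s^2\<close>; because \<open>1 \<le> M\<close>, the latter is at most
        \<open>(M * s)^2\<close>.\<close>
      have "M * s\<^sup>2 \<le> M * (M * s\<^sup>2)" using M mult_right_mono[of 1 M "s\<^sup>2"]
        by (intro mult_left_mono) auto
      also have "\<dots> = (M * s)\<^sup>2" by (simp add: power2_eq_square mult_ac)
      also have "\<dots> \<le> (2 * r)\<^sup>2" using M s unfolding r_def by (intro power_mono) auto
      finally have Ms: "M * s\<^sup>2 \<le> 4 * r\<^sup>2" by (simp add: power_mult_distrib)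
      have LL: "real L / sqrt L = sqrt L" using L0 by (simp add: real_div_sqrt)
      have "2 * \<theta> * (L * (16 * s\<^sup>2)) = 4 * (M * s\<^sup>2) / r * (real L / sqrt L)"
        unfolding \<theta>_def by simp
      also have "\<dots> \<le> 4 * (4 * r\<^sup>2) / r * (real L / sqrt L)"
        using Ms r0 by (intro mult_right_mono divide_right_mono mult_left_mono) auto
      also have "\<dots> = 16 * (r * sqrt L)" unfolding LL using r0 by (simp add: power2_eq_square)
      finally show ?thesis .
    qed
    have 3: "2 * \<theta> * ((4 * r)\<^sup>2 / 4) \<le> r * sqrt L"
    proof -
      have "2 * \<theta> * ((4 * r)\<^sup>2 / 4) = r * (M / sqrt L)"
        unfolding \<theta>_def using r0 sL by (simp add: field_simps power2_eq_square)
      also have "M / sqrt L \<le> 1" using M_le sL by (simp add: divide_le_eq)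
      also have "r * 1 \<le> r * sqrt L" using sL r0 by (intro mult_left_mono) auto
      finally show ?thesis using r0 by (simp add: mult_left_mono)
    qed
    have "3/2 * (4 * r) * sqrt L = 6 * (r * sqrt L)" "0 \<le> r * sqrt L" using r0 by simp_all
    \<comment> \<open>The contributions are 8, 6, 16 and 1 times \<open>r * sqrt L\<close>, in total
      31.\<close>
    then show ?thesis unfolding distrib_left[of "2 * \<theta>"] using 1 2 3 by linarith
  qed
  let ?ls = "map (\<lambda>(j, \<omega>). (j, h j, \<omega>)) js"
  have "set ?ls \<subseteq> {..<d} \<times> {..d} \<times> corners"
    using js(2) S(1) h_d unfolding J_def by auto
  moreover have "L2_set (\<lambda>i. cmod ((\<Sum>(j,h,\<omega>)\<leftarrow>?ls. 2 ^ h * \<omega> * a b i j)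
        - of_nat L * (\<Sum>j\<in>S. a b i j * x j))) {..<B} \<le> 32 * sqrt (real k * real B * real L)"
    if b: "b < m" for b
  proof -
    have eq: "(\<Sum>(j,h,\<omega>)\<leftarrow>?ls. 2 ^ h * \<omega> * a b i j) - of_nat L * (\<Sum>j\<in>S. a b i j * x j)
        = (\<Sum>q\<leftarrow>js. T b q i - z b i)" for i
    proof -
      have "(\<Sum>(j,h,\<omega>)\<leftarrow>map (\<lambda>(j, \<omega>). (j, h j, \<omega>)) ks. 2 ^ h * \<omega> * a b i j)
          - of_nat (length ks) * z b i = (\<Sum>q\<leftarrow>ks. T b q i - z b i)" for ks
        by (induction ks) (auto simp: T_def algebra_simps split: prod.splits)
      from this[of js] show ?thesis using js(1) by (simp add: z_def)
    qed
    have "sqrt (real k * real B * real L) = r * sqrt L" by (simp add: r_def real_sqrt_mult)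
    then show ?thesis unfolding eq using js(3)[OF b] bound by simp
  qed
  ultimately show ?thesis using js(1) by (intro exI[of _ ?ls]) auto
qed

subsection \<open>Chaining\<close>

text \<open>One representative is taken from each nonempty fibre of the code. The net therefore
  consists of points of \<open>T\<close> itself, as an admissible sequence requires.\<close>

lemma ex_cover_of_code:
  assumes code: "c ` T \<subseteq> K" and K: "finite K" "card K \<le> N"
    and fib: "\<And>x y. x \<in> T \<Longrightarrow> y \<in> T \<Longrightarrow> c x = c y \<Longrightarrow> \<rho> x y \<le> \<epsilon>"
  shows "\<exists>S\<subseteq>T. finite S \<and> card S \<le> N \<and> (\<forall>t\<in>T. \<exists>a\<in>S. \<rho> a t \<le> \<epsilon>)"
proof (intro exI conjI ballI)
  let ?S = "inv_into T c ` c ` T"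
  show "?S \<subseteq> T" by (auto intro: inv_into_into)
  have fin: "finite (c ` T)" using code K(1) finite_subset by blast
  then show "finite ?S" by simp
  have "card ?S \<le> card (c ` T)" by (rule card_image_le[OF fin])
  also have "\<dots> \<le> card K" using code K(1) by (intro card_mono)
  finally show "card ?S \<le> N" using K(2) by simp
  fix t assume t: "t \<in> T"
  then show "\<exists>a\<in>?S. \<rho> a t \<le> \<epsilon>"
    by (intro bexI[of _ "inv_into T c (c t)"] fib inv_into_into f_inv_into_f) auto
qed

lemma powr_half_nat: "2 powr (real n / 2) = sqrt 2 ^ n"
proof -
  have "2 powr (real n / 2) = (2 powr (1/2)) powr real n" by (simp add: powr_powr)
  also have "\<dots> = sqrt 2 ^ n" by (simp add: powr_half_sqrt powr_realpow)
  finally show ?thesis .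
qed

text \<open>Admissible sequences need not be nested, so the nets of different levels can be chosen
  independently. A bound \<open>e n\<close> uniform in \<open>t\<close> then dominates the series
  termwise.\<close>

lemma gamma2_le_suminf:
  assumes cov: "\<And>n. 1 \<le> n \<Longrightarrow> \<exists>S\<subseteq>T. finite S \<and> card S \<le> 2 ^ 2 ^ n \<and> (\<forall>t\<in>T. \<exists>a\<in>S. \<rho> a t \<le> e n)"
    and e0: "\<And>n. 0 \<le> e n"
    and sm: "(\<lambda>n. sqrt 2 ^ n * e n) sums X"
  shows "gamma2 T \<rho> \<le> ennreal X"
proof -
  have "\<forall>n. \<exists>S. 1 \<le> n \<longrightarrow> S \<subseteq> T \<and> finite S \<and> card S \<le> 2 ^ 2 ^ n \<and> (\<forall>t\<in>T. \<exists>a\<in>S. \<rho> a t \<le> e n)"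
    using cov by blast
  from choice[OF this] obtain S
    where S: "\<And>n. 1 \<le> n \<Longrightarrow> S n \<subseteq> T \<and> finite (S n) \<and> card (S n) \<le> 2 ^ 2 ^ n \<and>
      (\<forall>t\<in>T. \<exists>a\<in>S n. \<rho> a t \<le> e n)" by blast
  let ?f = "\<lambda>n. sqrt 2 ^ n * e n"
  have f0: "0 \<le> ?f n" for n using e0 by simp
  have smS: "summable (\<lambda>n. ?f (Suc n))" 
    using summable_Suc_iff[of ?f] sums_summable[OF sm] by simp
  have "admissible_seq T S" using S by (auto simp: admissible_seq_def)
  then have "gamma2 T \<rho> \<le> (SUP t\<in>T. \<Sum>n. ennreal (2 powr (real (Suc n) / 2)) *
      (INF a\<in>S (Suc n). ennreal (\<rho> a t)))"
    unfolding gamma2_def by (intro INF_lower) simp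
  also have "\<dots> \<le> ennreal X"
  proof (rule SUP_least)
    fix t assume t: "t \<in> T"
    have "ennreal (2 powr (real (Suc n) / 2)) * (INF a\<in>S (Suc n). ennreal (\<rho> a t))
        \<le> ennreal (?f (Suc n))" for n
    proof -
      obtain a where a: "a \<in> S (Suc n)" "\<rho> a t \<le> e (Suc n)" using S[of "Suc n"] t by auto
      have "(INF a\<in>S (Suc n). ennreal (\<rho> a t)) \<le> ennreal (\<rho> a t)" by (rule INF_lower[OF a(1)])
      also have "\<dots> \<le> ennreal (e (Suc n))" using a(2) by (rule ennreal_leI)
      finally show ?thesis
        unfolding powr_half_nat using e0 by (simp add: ennreal_mult mult_left_mono del: power_Suc)
    qed
    then have "(\<Sum>n. ennreal (2 powr (real (Suc n) / 2)) * (INF a\<in>S (Suc n). ennreal (\<rho> a t)))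
        \<le> (\<Sum>n. ennreal (?f (Suc n)))"
      by (intro suminf_le) auto
    also have "\<dots> = ennreal (\<Sum>n. ?f (Suc n))"
      by (rule suminf_ennreal2[OF f0 smS])
    also have "\<dots> \<le> ennreal X"
    proof (rule ennreal_leI)
      \<comment> \<open>The functional starts at index 1, whereas \<open>X\<close> also contains the
        nonnegative term at index 0.\<close>
      have "(\<Sum>n. ?f (Suc n)) = X - ?f 0"
        using suminf_split_head[OF sums_summable[OF sm]] sums_unique[OF sm] by simp
      then show "(\<Sum>n. ?f (Suc n)) \<le> X" using f0[of 0] by simp
    qed
    finally show "(\<Sum>n. ennreal (2 powr (real (Suc n) / 2)) * (INF a\<in>S (Suc n). ennreal (\<rho> a t)))
        \<le> ennreal X" .
  qed
  finally show ?thesis .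
qed

lemma sqrt2_bounds: "7/5 \<le> sqrt (2::real)" "sqrt (2::real) \<le> 3/2"
  by (rule real_le_rsqrt real_le_lsqrt; simp add: power2_eq_square)+

lemma sqrt2_power_sq: "(sqrt 2 ^ n)\<^sup>2 = (2::real) ^ n"
  by (simp add: power2_eq_square power_mult_distrib[symmetric])

text \<open>With the weights \<open>sqrt 2 ^ n\<close> the first range is an increasing geometric
  sum, the middle range has constant terms \<open>K\<close>, and the tail decays with ratio
  \<open>1 / sqrt 2\<close>. The factors 3 and 4 follow from
  \<open>7/5 \<le> sqrt 2\<close>.\<close>

lemma ex_chain_sum_le:
  fixes s K G :: real
  assumes nn: "n1 \<le> n2" and pos: "0 \<le> s" "0 \<le> K" "0 \<le> G"
  defines "e \<equiv> \<lambda>n. if n < n1 then s else if n < n2 then K / sqrt 2 ^ n else G / 2 ^ n"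
  shows "\<exists>X. (\<lambda>n. sqrt 2 ^ n * e n) sums X \<and>
    X \<le> 3 * (sqrt 2 ^ n1 * s) + real (n2 - n1) * K + 4 * (G / sqrt 2 ^ n2)"
proof -
  let ?q = "1 / sqrt (2::real)"
  have q: "0 < ?q" "norm ?q < 1" by auto
  have 1: "(\<lambda>n. if n \<in> {..<n1} then sqrt 2 ^ n * s else 0) sums (\<Sum>n<n1. sqrt 2 ^ n * s)"
    by (rule sums_If_finite_set) simp
  have 2: "(\<lambda>n. if n \<in> {n1..<n2} then K else 0) sums (\<Sum>n\<in>{n1..<n2}. K)"
    by (rule sums_If_finite_set) simp
  have "(\<lambda>n. (G * ?q ^ n2) * ?q ^ n) sums ((G * ?q ^ n2) * (1 / (1 - ?q)))"
    by (intro sums_mult geometric_sums q)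
  then have 3: "(\<lambda>n. if n < n2 then 0 else G * ?q ^ n) sums ((G * ?q ^ n2) * (1 / (1 - ?q)))"
    by (subst sums_zero_iff_shift[symmetric, of n2]) (auto simp: power_add mult_ac)
  have eq: "sqrt 2 ^ n * e n = (if n \<in> {..<n1} then sqrt 2 ^ n * s else 0) +
      (if n \<in> {n1..<n2} then K else 0) + (if n < n2 then 0 else G * ?q ^ n)" for n
  proof -
    have "sqrt 2 ^ n * (G / 2 ^ n) = G * ?q ^ n"
      using sqrt2_power_sq[of n] by (simp add: power_divide field_simps power2_eq_square)
    then show ?thesis using nn by (auto simp: e_def)
  qed
  let ?X = "(\<Sum>n<n1. sqrt 2 ^ n * s) + (\<Sum>n\<in>{n1..<n2}. K) + (G * ?q ^ n2) * (1 / (1 - ?q))"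
  have "(\<lambda>n. sqrt 2 ^ n * e n) sums ?X"
    unfolding eq by (intro sums_add 1 2 3)
  moreover have "(\<Sum>n<n1. sqrt 2 ^ n * s) \<le> 3 * (sqrt 2 ^ n1 * s)"
  proof -
    have "(\<Sum>n<n1. sqrt 2 ^ n) \<le> 3 * sqrt (2::real) ^ n1"
    proof (induction n1)
      case (Suc n)
      have "(4::real) * sqrt 2 ^ n \<le> (3 * sqrt 2) * sqrt 2 ^ n"
        using sqrt2_bounds by (intro mult_right_mono) auto
      also have "\<dots> = 3 * sqrt 2 ^ Suc n" by simp
      finally show ?case using Suc.IH unfolding sum.lessThan_Suc by linarith
    qed simp
    then show ?thesis
      using pos(1) mult_right_mono[of _ _ s] by (simp add: sum_distrib_right[symmetric] mult.assoc[symmetric])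
  qed
  moreover have "(G * ?q ^ n2) * (1 / (1 - ?q)) \<le> 4 * (G / sqrt 2 ^ n2)"
  proof -
    have "?q \<le> 1 / (7/5)" using sqrt2_bounds by (intro divide_left_mono) auto
    then have "1 / (1 - ?q) \<le> 1 / (1/4)" by (intro divide_left_mono) auto
    then have "(G * ?q ^ n2) * (1 / (1 - ?q)) \<le> (G * ?q ^ n2) * 4"
      using pos(3) by (intro mult_left_mono) auto
    then show ?thesis by (simp add: power_divide mult.commute)
  qed
  ultimately show ?thesis by (intro exI[of _ ?X]) auto
qed

subsection \<open>Nets in the sparse ball\<close>

lemma l2norm_row_block:
  assumes "A \<in> carrier_mat (m * B) d" "x \<in> carrier_vec d"
  shows "l2norm (row_block B A b *\<^sub>v x)
    = L2_set (\<lambda>i. cmod (\<Sum>j<d. A $$ (B * b + i, j) * x $ j)) {..<B}"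
proof -
  have "(row_block B A b *\<^sub>v x) $ i = (\<Sum>j<d. A $$ (B * b + i, j) * x $ j)" if "i < B" for i
    using assms that by (auto simp: row_block_def scalar_prod_def lessThan_atLeast0 intro!: sum.cong)
  moreover have "dim_vec (row_block B A b *\<^sub>v x) = B" by (simp add: row_block_def)
  ultimately show ?thesis unfolding l2norm_def L2_set_def by simp
qed

lemma norm_X_diff_le_iff:
  assumes "A \<in> carrier_mat (m * B) d" "x \<in> carrier_vec d" "y \<in> carrier_vec d" "0 < m"
  shows "norm_X m B A (x - y) \<le> \<epsilon> \<longleftrightarrow>
    (\<forall>b<m. L2_set (\<lambda>i. cmod ((\<Sum>j<d. A $$ (B * b + i, j) * x $ j)
        - (\<Sum>j<d. A $$ (B * b + i, j) * y $ j))) {..<B} \<le> \<epsilon>)"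
proof -
  have "(\<Sum>j<d. A $$ (B * b + i, j) * (x - y) $ j)
      = (\<Sum>j<d. A $$ (B * b + i, j) * x $ j) - (\<Sum>j<d. A $$ (B * b + i, j) * y $ j)" for b i
    using assms(2,3) by (simp add: sum_subtractf[symmetric] right_diff_distrib)
  then have "l2norm (row_block B A b *\<^sub>v (x - y)) = L2_set (\<lambda>i. cmod
      ((\<Sum>j<d. A $$ (B * b + i, j) * x $ j) - (\<Sum>j<d. A $$ (B * b + i, j) * y $ j))) {..<B}" for b
    using assms(2,3) by (subst l2norm_row_block[OF assms(1)]) auto
  then show ?thesis unfolding norm_X_def using assms(4)
    by (subst Max_le_iff) auto
qed

lemma sparse_ball_support:
  assumes x: "x \<in> sparse_ball d k" and d: "0 < d" and k: "0 < k"
  shows "\<exists>S\<subseteq>{..<d}. S \<noteq> {} \<and> card S \<le> k \<and> (\<Sum>j\<in>S. (cmod (x $ j))\<^sup>2) \<le> 1 \<and>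
    (\<forall>j<d. j \<notin> S \<longrightarrow> x $ j = 0) \<and> (\<forall>f. (\<Sum>j<d. f j * x $ j) = (\<Sum>j\<in>S. f j * x $ j))"
proof -
  define U where "U = {i. i < d \<and> x $ i \<noteq> 0}"
  \<comment> \<open>The zero vector receives the dummy support \<open>{0}\<close>: sampling needs a
    nonempty set, and \<open>0 < k\<close> leaves room for one index.\<close>
  define S where "S = (if U = {} then {0} else U)"
  have S: "S \<subseteq> {..<d}" using d by (auto simp: S_def U_def)
  have z: "x $ j = 0" if "j < d" "j \<notin> S" for j
    using that by (auto simp: S_def U_def split: if_splits)
  have dim: "dim_vec x = d" and l2: "l2norm x \<le> 1" and c: "card U \<le> k"
    using x by (auto simp: sparse_ball_def U_def)
  have "(\<Sum>i<d. (cmod (x $ i))\<^sup>2) \<le> 1" using l2 unfolding l2norm_def dim by simp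
  moreover have "(\<Sum>j\<in>S. (cmod (x $ j))\<^sup>2) \<le> (\<Sum>i<d. (cmod (x $ i))\<^sup>2)"
    using S by (intro sum_mono2) auto
  moreover have "(\<Sum>j<d. f j * x $ j) = (\<Sum>j\<in>S. f j * x $ j)" for f
    using S z by (intro sum.mono_neutral_right) auto
  moreover have "card S \<le> k" using c k by (auto simp: S_def)
  moreover have "S \<noteq> {}" by (simp add: S_def)
  ultimately show ?thesis using S z by (intro exI[of _ S]) simp
qed

lemma L2_set_le_const:
  assumes "\<And>i. i < B \<Longrightarrow> 0 \<le> f i \<and> f i \<le> c" "0 \<le> c"
  shows "L2_set f {..<B} \<le> sqrt (real B) * c"
proof -
  have "L2_set f {..<B} \<le> L2_set (\<lambda>_. c) {..<B}"
    using assms by (intro L2_set_mono) auto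
  also have "\<dots> = sqrt (real B) * c" using assms(2) by (simp add: L2_set_def real_sqrt_mult)
  finally show ?thesis .
qed

lemma block_row_less:
  fixes b i m B :: nat
  assumes "b < m" "i < B"
  shows "B * b + i < m * B"
proof -
  have "B * b + i < B * Suc b" using assms(2) by simp
  also have "\<dots> \<le> B * m" using assms(1) by (intro mult_le_mono2) simp
  finally show ?thesis by (simp add: mult.commute)
qed

text \<open>Each row pairs with \<open>x\<close> to at most the l1 norm, hence to at most
  \<open>sqrt k\<close>. This trivial bound shows that the suprema of the theorem's hypothesis are
  over bounded sets, and it suffices when \<open>ln m\<close> is small.\<close>

lemma row_block_norm_le:
  assumes A: "A \<in> carrier_mat (m * B) d" "\<And>i j. i < m * B \<Longrightarrow> j < d \<Longrightarrow> cmod (A $$ (i, j)) \<le> 1"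
    and b: "b < m" and d: "0 < d" and k: "0 < k" and x: "x \<in> sparse_ball d k"
  shows "l2norm (row_block B A b *\<^sub>v x) \<le> sqrt (real k * real B)"
proof -
  obtain S where S: "S \<subseteq> {..<d}" "card S \<le> k" "(\<Sum>j\<in>S. (cmod (x $ j))\<^sup>2) \<le> 1"
    "\<And>f. (\<Sum>j<d. f j * x $ j) = (\<Sum>j\<in>S. f j * x $ j)"
    using sparse_ball_support[OF x d k] by blast
  have xc: "x \<in> carrier_vec d" using x by (simp add: sparse_ball_def)
  have "cmod (\<Sum>j<d. A $$ (B * b + i, j) * x $ j) \<le> sqrt (real k)" if i: "i < B" for i
  proof -
    have bi: "B * b + i < m * B" using b i by (rule block_row_less)
    have "cmod (\<Sum>j\<in>S. A $$ (B * b + i, j) * x $ j) \<le> (\<Sum>j\<in>S. 1 * cmod (x $ j))"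
      using A(2)[OF bi] S(1)
      by (intro order_trans[OF norm_sum] sum_mono) (auto simp: norm_mult intro!: mult_left_le_one_le)
    also have "\<dots> \<le> sqrt (real k)"
      using sum_cmod_le[OF _ S(2,3)] S(1) finite_subset by auto
    finally show ?thesis unfolding S(4) .
  qed
  then have "l2norm (row_block B A b *\<^sub>v x) \<le> sqrt (real B) * sqrt (real k)"
    unfolding l2norm_row_block[OF A(1) xc] by (intro L2_set_le_const) auto
  then show ?thesis by (simp add: real_sqrt_mult mult.commute)
qed

text \<open>Homogeneity: dividing \<open>y\<close> by its norm on \<open>S\<close> and extending by
  zero gives a point of the sparse ball. The case of norm zero is separate because nothing can be
  divided there.\<close>

lemma row_block_op_le:
  assumes A: "A \<in> carrier_mat (m * B) d"
    and op: "\<And>x. x \<in> sparse_ball d k \<Longrightarrow> l2norm (row_block B A b *\<^sub>v x) \<le> s"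
    and S: "S \<subseteq> {..<d}" "card S \<le> k"
  shows "L2_set (\<lambda>i. cmod (\<Sum>j\<in>S. A $$ (B * b + i, j) * y j)) {..<B}
    \<le> s * L2_set (\<lambda>j. cmod (y j)) S"
proof -
  let ?t = "L2_set (\<lambda>j. cmod (y j)) S"
  have finS: "finite S" using S(1) finite_subset by blast
  show ?thesis
  proof (cases "?t = 0")
    case True
    then have "\<And>j. j \<in> S \<Longrightarrow> y j = 0" using finS by (simp add: L2_set_eq_0_iff)
    then show ?thesis using True by (simp add: L2_set_def)
  next
    case False
    then have t: "0 < ?t" using L2_set_nonneg[of "\<lambda>j. cmod (y j)" S] by linarith
    define x where "x = vec d (\<lambda>j. if j \<in> S then y j / of_real ?t else 0)"
    have xc: "x \<in> carrier_vec d" by (simp add: x_def)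
    have xin: "x \<in> sparse_ball d k"
    proof -
      have "card {i. i < d \<and> x $ i \<noteq> 0} \<le> card S"
        using finS by (intro card_mono) (auto simp: x_def split: if_splits)
      moreover have "(\<Sum>i<d. (cmod (x $ i))\<^sup>2) = (\<Sum>j\<in>S. (cmod (y j))\<^sup>2 / ?t\<^sup>2)"
      proof -
        have "(\<Sum>i<d. (cmod (x $ i))\<^sup>2) = (\<Sum>j\<in>S. (cmod (x $ j))\<^sup>2)"
          using S(1) by (intro sum.mono_neutral_right) (auto simp: x_def)
        also have "\<dots> = (\<Sum>j\<in>S. (cmod (y j))\<^sup>2 / ?t\<^sup>2)"
          using S(1) t by (intro sum.cong) (auto simp: x_def norm_divide power_divide)
        finally show ?thesis .
      qed
      then have "(\<Sum>i<d. (cmod (x $ i))\<^sup>2) = 1"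
        using t by (simp add: sum_divide_distrib[symmetric] L2_set_def sum_nonneg)
      ultimately show ?thesis using S(2) xc by (auto simp: sparse_ball_def l2norm_def)
    qed
    have "(\<Sum>j<d. A $$ (B * b + i, j) * x $ j) = (\<Sum>j\<in>S. A $$ (B * b + i, j) * y j) / of_real ?t"
      for i
    proof -
      have "(\<Sum>j<d. A $$ (B * b + i, j) * x $ j) = (\<Sum>j\<in>S. A $$ (B * b + i, j) * x $ j)"
        using S(1) by (intro sum.mono_neutral_right) (auto simp: x_def)
      also have "\<dots> = (\<Sum>j\<in>S. A $$ (B * b + i, j) * y j / of_real ?t)"
        using S(1) by (intro sum.cong) (auto simp: x_def)
      finally show ?thesis by (simp add: sum_divide_distrib)
    qed
    then have "l2norm (row_block B A b *\<^sub>v x)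
        = L2_set (\<lambda>i. cmod (\<Sum>j\<in>S. A $$ (B * b + i, j) * y j) * (1 / ?t)) {..<B}"
      unfolding l2norm_row_block[OF A xc] using t by (simp add: norm_divide)
    also have "\<dots> = L2_set (\<lambda>i. cmod (\<Sum>j\<in>S. A $$ (B * b + i, j) * y j)) {..<B} * (1 / ?t)"
      using t by (subst L2_set_left_distrib) auto
    finally show ?thesis using op[OF xin] t by (simp add: divide_le_eq)
  qed
qed

text \<open>The code of a vector is its list of sampled labels. Two vectors with the same list are
  both compared with the same decoded sum, so \<open>L\<close> times their distance is at most twice
  the sampling error; this turns 32 into 64.\<close>

lemma ex_maurey_cover:
  assumes A: "A \<in> carrier_mat (m * B) d" "\<And>i j. i < m * B \<Longrightarrow> j < d \<Longrightarrow> cmod (A $$ (i, j)) \<le> 1"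
    and op: "\<And>b x. b < m \<Longrightarrow> x \<in> sparse_ball d k \<Longrightarrow> l2norm (row_block B A b *\<^sub>v x) \<le> s"
    and s: "0 \<le> s" and M: "1 \<le> M" "ln (real m) \<le> M" "M * s \<le> 2 * sqrt (real k * real B)"
    and L: "M\<^sup>2 \<le> real L" and pos: "0 < m" "0 < B" "0 < d" "0 < k"
  shows "\<exists>S\<subseteq>sparse_ball d k. finite S \<and> card S \<le> (4 * d * (d + 1)) ^ L \<and>
    (\<forall>t\<in>sparse_ball d k. \<exists>a\<in>S. norm_X m B A (a - t) \<le> 64 * sqrt (real k * real B / real L))"
proof -
  define z where "z x b i = (\<Sum>j<d. A $$ (B * b + i, j) * x $ j)" for x :: "complex vec" and b i
  define dec where "dec ls b i = (\<Sum>(j,h,\<omega>)\<leftarrow>ls. 2 ^ h * \<omega> * A $$ (B * b + i, j))"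
    for ls :: "(nat \<times> nat \<times> complex) list" and b i
  let ?V = "{..<d} \<times> {..d} \<times> corners"
  let ?K = "{ls. set ls \<subseteq> ?V \<and> length ls = L}"
  let ?E = "32 * sqrt (real k * real B * real L)"
  have L0: "0 < real L"
  proof -
    have "1 \<le> M\<^sup>2" using M(1) by simp
    then show ?thesis using L by linarith
  qed
  have ex: "\<exists>ls. ls \<in> ?K \<and> (\<forall>b<m. L2_set (\<lambda>i. cmod (dec ls b i - of_nat L * z x b i)) {..<B} \<le> ?E)"
    if x: "x \<in> sparse_ball d k" for x
  proof -
    obtain S where S: "S \<subseteq> {..<d}" "S \<noteq> {}" "card S \<le> k" "(\<Sum>j\<in>S. (cmod (x $ j))\<^sup>2) \<le> 1"
      "\<And>f. (\<Sum>j<d. f j * x $ j) = (\<Sum>j\<in>S. f j * x $ j)"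
      using sparse_ball_support[OF x pos(3,4)] by blast
    have "cmod (A $$ (B * b + i, j)) \<le> 1" if "b < m" "i < B" "j < d" for b i j
      by (rule A(2)[OF block_row_less[OF that(1,2)] that(3)])
    from ex_maurey_labels[where a = "\<lambda>b i j. A $$ (B * b + i, j)", OF S(1-4) this row_block_op_le[OF A(1) op S(1,3)] s M L pos(1,2)]
    show ?thesis unfolding dec_def z_def S(5) by blast
  qed
  have "\<exists>c. \<forall>x\<in>sparse_ball d k. c x \<in> ?K \<and>
      (\<forall>b<m. L2_set (\<lambda>i. cmod (dec (c x) b i - of_nat L * z x b i)) {..<B} \<le> ?E)"
    by (rule bchoice) (use ex in blast)
  then obtain c where c: "\<And>x. x \<in> sparse_ball d k \<Longrightarrow> c x \<in> ?K"
    "\<And>x b. x \<in> sparse_ball d k \<Longrightarrow> b < m \<Longrightarrow>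
        L2_set (\<lambda>i. cmod (dec (c x) b i - of_nat L * z x b i)) {..<B} \<le> ?E"
    by blast
  have fV: "finite ?V" using finite_corners by simp
  show ?thesis
  proof (rule ex_cover_of_code)
    show "c ` sparse_ball d k \<subseteq> ?K" using c(1) by blast
    show "finite ?K" using fV by (rule finite_lists_length_eq)
    have "card ?V = 4 * d * (d + 1)" by (simp add: card_cartesian_product card_corners algebra_simps)
    then show "card ?K \<le> (4 * d * (d + 1)) ^ L" using card_lists_length_eq[OF fV, of L] by simp
    fix x y assume x: "x \<in> sparse_ball d k" and y: "y \<in> sparse_ball d k" and eq: "c x = c y"
    have xy: "x \<in> carrier_vec d" "y \<in> carrier_vec d" using x y by (auto simp: sparse_ball_def)
    have "L2_set (\<lambda>i. cmod (z x b i - z y b i)) {..<B} \<le> 64 * sqrt (real k * real B / real L)"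
      if b: "b < m" for b
    proof -
      have "real L * L2_set (\<lambda>i. cmod (z x b i - z y b i)) {..<B}
          = L2_set (\<lambda>i. real L * cmod (z x b i - z y b i)) {..<B}"
        using L0 by (subst L2_set_right_distrib) auto
      also have "\<dots> \<le> L2_set (\<lambda>i. cmod (dec (c x) b i - of_nat L * z x b i)
          + cmod (dec (c y) b i - of_nat L * z y b i)) {..<B}"
      proof (intro L2_set_mono)
        fix i
        have "(dec (c y) b i - of_nat L * z y b i) - (dec (c x) b i - of_nat L * z x b i)
            = of_nat L * (z x b i - z y b i)"
          by (simp add: eq right_diff_distrib)
        then have "real L * cmod (z x b i - z y b i)
            = cmod ((dec (c y) b i - of_nat L * z y b i) - (dec (c x) b i - of_nat L * z x b i))"
          by (simp only: norm_mult norm_of_nat)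
        also have "\<dots> \<le> cmod (dec (c y) b i - of_nat L * z y b i)
            + cmod (dec (c x) b i - of_nat L * z x b i)"
          by (rule norm_triangle_ineq4)
        finally show "real L * cmod (z x b i - z y b i) \<le> cmod (dec (c x) b i - of_nat L * z x b i)
            + cmod (dec (c y) b i - of_nat L * z y b i)" by simp
      qed simp
      also have "\<dots> \<le> L2_set (\<lambda>i. cmod (dec (c x) b i - of_nat L * z x b i)) {..<B}
          + L2_set (\<lambda>i. cmod (dec (c y) b i - of_nat L * z y b i)) {..<B}"
        by (rule L2_set_triangle_ineq)
      also have "\<dots> \<le> ?E + ?E" by (intro add_mono c(2) x y b)
      also have "\<dots> = real L * (64 * sqrt (real k * real B / real L))"
      proof -
        have "sqrt (real k * real B * real L) = real L * sqrt (real k * real B / real L)"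
          using L0 by (simp add: real_sqrt_mult real_sqrt_divide field_simps)
        then show ?thesis by simp
      qed
      finally show ?thesis using L0 by simp
    qed
    then show "norm_X m B A (x - y) \<le> 64 * sqrt (real k * real B / real L)"
      unfolding norm_X_diff_le_iff[OF A(1) xy pos(1)] z_def by blast
  qed
qed

section \<open>Coordinatewise grid nets\<close>

lemma floor_grid_diff_le:
  fixes r t :: real
  assumes "\<lfloor>r * 2 ^ q\<rfloor> = \<lfloor>t * 2 ^ q\<rfloor>"
  shows "\<bar>r - t\<bar> \<le> 1 / 2 ^ q"
proof -
  have "\<bar>r * 2 ^ q - t * 2 ^ q\<bar> \<le> 1" using assms by linarith
  then have "\<bar>r - t\<bar> * 2 ^ q \<le> 1" by (simp add: left_diff_distrib[symmetric] abs_mult)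
  then show ?thesis by (simp add: pos_le_divide_eq)
qed

text \<open>The code lists a support together with the coordinates rounded to mesh
  \<open>1 / 2 ^ q\<close>. Equal codes have equal supports and coordinates within
  \<open>2 / 2 ^ q\<close>; each row adds up at most \<open>k\<close> such errors, and the
  \<open>B\<close> rows give the factor \<open>sqrt B\<close>.\<close>

lemma ex_grid_cover:
  assumes A: "A \<in> carrier_mat (m * B) d" "\<And>i j. i < m * B \<Longrightarrow> j < d \<Longrightarrow> cmod (A $$ (i, j)) \<le> 1"
    and pos: "0 < m" "0 < d" "0 < k"
  shows "\<exists>S\<subseteq>sparse_ball d k. finite S \<and> card S \<le> (d * 2 ^ (2 * q + 4)) ^ k \<and>
    (\<forall>t\<in>sparse_ball d k. \<exists>a\<in>S. norm_X m B A (a - t) \<le> 2 * real k * sqrt (real B) / 2 ^ q)"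
proof -
  let ?G = "{- (2 ^ q)..2 ^ q} :: int set"
  let ?V = "{..<d} \<times> ?G \<times> ?G"
  let ?K = "{ls. set ls \<subseteq> ?V \<and> length ls = k}"
  have ex: "\<exists>js. length js = k \<and> set js \<subseteq> {..<d} \<and> (\<forall>j<d. j \<notin> set js \<longrightarrow> x $ j = 0)"
    if x: "x \<in> sparse_ball d k" for x
  proof -
    obtain S where S: "S \<subseteq> {..<d}" "S \<noteq> {}" "card S \<le> k"
      "(\<Sum>j\<in>S. (cmod (x $ j))\<^sup>2) \<le> 1" "\<And>j. j < d \<Longrightarrow> j \<notin> S \<Longrightarrow> x $ j = 0"
      "\<And>f. (\<Sum>j<d. f j * x $ j) = (\<Sum>j\<in>S. f j * x $ j)"
      using sparse_ball_support[OF x pos(2,3)] by blast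
    obtain xs where xs: "set xs = S" "distinct xs"
      using finite_distinct_list[OF finite_subset[OF S(1)]] by blast
    then have len: "length xs \<le> k" using S(3) distinct_card by force
    obtain j0 where j0: "j0 \<in> S" using S(2) by blast
    \<comment> \<open>Repeating an index pads the list to length exactly \<open>k\<close> without
      changing its set.\<close>
    let ?js = "xs @ replicate (k - length xs) j0"
    have "set ?js = S" using xs j0 by auto
    then show ?thesis using S len by (intro exI[of _ ?js]) auto
  qed
  have "\<exists>js. \<forall>x\<in>sparse_ball d k. length (js x) = k \<and> set (js x) \<subseteq> {..<d} \<and>
      (\<forall>j<d. j \<notin> set (js x) \<longrightarrow> x $ j = 0)"
    by (rule bchoice) (use ex in blast)
  then obtain js where js: "\<And>x. x \<in> sparse_ball d k \<Longrightarrow> length (js x) = k"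
      "\<And>x. x \<in> sparse_ball d k \<Longrightarrow> set (js x) \<subseteq> {..<d}"
      "\<And>x j. x \<in> sparse_ball d k \<Longrightarrow> j < d \<Longrightarrow> j \<notin> set (js x) \<Longrightarrow> x $ j = 0"
    by blast
  define c where "c x = map (\<lambda>j. (j, \<lfloor>Re (x $ j) * 2 ^ q\<rfloor>, \<lfloor>Im (x $ j) * 2 ^ q\<rfloor>)) (js x)" for x
  have G: "\<lfloor>r * 2 ^ q\<rfloor> \<in> ?G" if "\<bar>r\<bar> \<le> 1" for r :: real
  proof -
    have "\<bar>r * 2 ^ q\<bar> \<le> 1 * 2 ^ q" unfolding abs_mult using that by (intro mult_mono) auto
    then have "- (2 ^ q) \<le> r * 2 ^ q" "r * 2 ^ q < 2 ^ q + 1" by linarith+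
    then show ?thesis by (simp add: le_floor_iff floor_le_iff)
  qed
  have cG: "\<bar>Re (x $ j)\<bar> \<le> 1 \<and> \<bar>Im (x $ j)\<bar> \<le> 1" if x: "x \<in> sparse_ball d k" and j: "j < d" for x j
  proof -
    have "dim_vec x = d" "l2norm x \<le> 1" using x by (auto simp: sparse_ball_def)
    then have "(\<Sum>i<d. (cmod (x $ i))\<^sup>2) \<le> 1" by (simp add: l2norm_def)
    moreover have "(cmod (x $ j))\<^sup>2 \<le> (\<Sum>i<d. (cmod (x $ i))\<^sup>2)"
      using j by (intro member_le_sum) auto
    ultimately have "(cmod (x $ j))\<^sup>2 \<le> 1\<^sup>2" by simp
    then have "cmod (x $ j) \<le> 1" by (rule power2_le_imp_le) simp
    then show ?thesis using abs_Re_le_cmod[of "x $ j"] abs_Im_le_cmod[of "x $ j"] by linarith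
  qed
  have fV: "finite ?V" by simp
  show ?thesis
  proof (rule ex_cover_of_code)
    show "c ` sparse_ball d k \<subseteq> ?K"
    proof
      fix l assume "l \<in> c ` sparse_ball d k"
      then obtain x where x: "x \<in> sparse_ball d k" "l = c x" by blast
      have "(j, \<lfloor>Re (x $ j) * 2 ^ q\<rfloor>, \<lfloor>Im (x $ j) * 2 ^ q\<rfloor>) \<in> ?V" if "j \<in> set (js x)" for j
      proof -
        have "j < d" using js(2)[OF x(1)] that by auto
        with cG[OF x(1) this] G show ?thesis by blast
      qed
      then show "l \<in> ?K" using js(1)[OF x(1)] unfolding x(2) c_def by auto
    qed
    show "finite ?K" using fV by (rule finite_lists_length_eq)
    have "card ?V = d * (2 * 2 ^ q + 1)\<^sup>2"
      by (simp add: card_cartesian_product power2_eq_square nat_add_distrib nat_mult_distrib nat_power_eq)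
    \<comment> \<open>Rounding the number of grid values up to a power of two allows the count to be
      compared with \<open>2 ^ 2 ^ n\<close> on the level of exponents.\<close>
    also have "\<dots> \<le> d * (2 ^ (q + 2))\<^sup>2"
      by (intro mult_le_mono2 power_mono) (auto simp: power_add)
    also have "(2 ^ (q + 2))\<^sup>2 = (2::nat) ^ (2 * q + 4)"
      unfolding power_mult[symmetric] by (rule arg_cong[where f = "(^) 2"]) simp
    finally have "card ?V ^ k \<le> (d * 2 ^ (2 * q + 4)) ^ k" by (rule power_mono) simp
    then show "card ?K \<le> (d * 2 ^ (2 * q + 4)) ^ k" using card_lists_length_eq[OF fV, of k] by simp
    fix x y assume x: "x \<in> sparse_ball d k" and y: "y \<in> sparse_ball d k" and eq: "c x = c y"
    have xy: "x \<in> carrier_vec d" "y \<in> carrier_vec d" using x y by (auto simp: sparse_ball_def)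
    have "map fst (c x) = map fst (c y)" using eq by simp
    then have jeq: "js x = js y" by (simp add: c_def o_def)
    have diff: "cmod (x $ j - y $ j) \<le> 2 / 2 ^ q" if j: "j \<in> set (js x)" for j
    proof -
      have "\<lfloor>Re (x $ j) * 2 ^ q\<rfloor> = \<lfloor>Re (y $ j) * 2 ^ q\<rfloor>" "\<lfloor>Im (x $ j) * 2 ^ q\<rfloor> = \<lfloor>Im (y $ j) * 2 ^ q\<rfloor>"
        using eq j unfolding c_def jeq by auto
      then have "\<bar>Re (x $ j - y $ j)\<bar> \<le> 1 / 2 ^ q" "\<bar>Im (x $ j - y $ j)\<bar> \<le> 1 / 2 ^ q"
        using floor_grid_diff_le by auto
      then show ?thesis using cmod_le[of "x $ j - y $ j"] by simp
    qed
    have "L2_set (\<lambda>i. cmod ((\<Sum>j<d. A $$ (B * b + i, j) * x $ j)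
        - (\<Sum>j<d. A $$ (B * b + i, j) * y $ j))) {..<B} \<le> sqrt (real B) * (2 * real k / 2 ^ q)"
      if b: "b < m" for b
    proof (intro L2_set_le_const conjI norm_ge_zero)
      fix i assume i: "i < B"
      have bi: "B * b + i < m * B" using b i by (rule block_row_less)
      have "(\<Sum>j<d. A $$ (B * b + i, j) * x $ j) - (\<Sum>j<d. A $$ (B * b + i, j) * y $ j)
          = (\<Sum>j<d. A $$ (B * b + i, j) * (x $ j - y $ j))"
        by (simp add: sum_subtractf[symmetric] right_diff_distrib)
      also have "\<dots> = (\<Sum>j\<in>set (js x). A $$ (B * b + i, j) * (x $ j - y $ j))"
        using js(2)[OF x] js(3)[OF x] js(3)[OF y] jeq by (intro sum.mono_neutral_right) auto
      also have "cmod \<dots> \<le> (\<Sum>j\<in>set (js x). 1 * (2 / 2 ^ q))"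
        unfolding norm_mult using A(2)[OF bi] js(2)[OF x] diff
        by (intro order_trans[OF norm_sum] sum_mono) (unfold norm_mult, intro mult_mono, auto)
      also have "\<dots> = real (card (set (js x))) * (2 / 2 ^ q)" by simp
      also have "\<dots> \<le> real k * (2 / 2 ^ q)"
        using card_length[of "js x"] js(1)[OF x] by (intro mult_right_mono) auto
      finally show "cmod ((\<Sum>j<d. A $$ (B * b + i, j) * x $ j)
        - (\<Sum>j<d. A $$ (B * b + i, j) * y $ j)) \<le> 2 * real k / 2 ^ q"
        by (simp add: mult.commute)
    qed simp
    then show "norm_X m B A (x - y) \<le> 2 * real k * sqrt (real B) / 2 ^ q"
      unfolding norm_X_diff_le_iff[OF A(1) xy pos(1)] by (simp add: mult_ac)
  qed
qed

section \<open>Cardinality estimates and assembly of the chain\<close>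

lemma pow_mult_pow2_le:
  assumes "0 < d" "real N * log 2 (real d) + real E \<le> real P"
  shows "d ^ N * 2 ^ E \<le> (2::nat) ^ P"
proof -
  have "real d ^ N = 2 powr (real N * log 2 (real d))"
  proof -
    have "2 powr (real N * log 2 (real d)) = (2 powr log 2 (real d)) powr real N"
      by (simp add: powr_powr mult.commute)
    then show ?thesis using assms(1) by (simp add: powr_realpow)
  qed
  then have "real d ^ N * 2 ^ E = 2 powr (real N * log 2 (real d) + real E)"
    by (simp add: powr_add powr_realpow)
  also have "\<dots> \<le> 2 powr real P" using assms(2) by (intro powr_mono) auto
  also have "\<dots> = 2 ^ P" by (simp add: powr_realpow)
  finally have "real (d ^ N * 2 ^ E) \<le> real (2 ^ P)" by simp
  then show ?thesis by (simp only: of_nat_le_iff)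
qed

text \<open>Bernoulli's inequality with \<open>sqrt 2 - 1 \<ge> 2/5\<close>. It is used to absorb
  the exponent \<open>k * (2 * n + 4)\<close> of the grid count once \<open>sqrt 2 ^ n\<close>
  exceeds \<open>16 k\<close>.\<close>

lemma add_two_le_sqrt2_power: "real n + 2 \<le> 4 * sqrt 2 ^ n"
proof -
  have "1 + real n * (sqrt 2 - 1) \<le> (1 + (sqrt 2 - 1)) ^ n"
    using sqrt2_bounds by (intro Bernoulli_inequality) auto
  moreover have "real n * (2/5) \<le> real n * (sqrt 2 - 1)"
    using sqrt2_bounds by (intro mult_left_mono) auto
  ultimately show ?thesis by simp
qed

text \<open>The left side is the number of Maurey labels. As a pure power of \<open>d\<close> it
  bounds the number of label lists of length \<open>L\<close> by \<open>d ^ (5 * L)\<close>.\<close>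

lemma label_count_le:
  fixes d :: nat
  assumes "2 \<le> d"
  shows "4 * d * (d + 1) \<le> d ^ 5"
proof -
  have "4 * d * (d + 1) \<le> 4 * d * (2 * d)" using assms by (intro mult_le_mono2) simp
  also have "\<dots> = 2 ^ 3 * d ^ 2" by (simp add: power2_eq_square)
  also have "\<dots> \<le> d ^ 3 * d ^ 2" using assms by (intro mult_le_mono1 power_mono) auto
  also have "\<dots> = d ^ 5" by (simp add: power_add[symmetric])
  finally show ?thesis .
qed

lemma cover_mono:
  assumes "\<exists>S\<subseteq>T. finite S \<and> card S \<le> N \<and> (\<forall>t\<in>T. \<exists>a\<in>S. \<rho> a t \<le> (\<epsilon>::real))" "N \<le> N'" "\<epsilon> \<le> \<epsilon>'"
  shows "\<exists>S\<subseteq>T. finite S \<and> card S \<le> N' \<and> (\<forall>t\<in>T. \<exists>a\<in>S. \<rho> a t \<le> \<epsilon>')"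
proof -
  obtain S where S: "S \<subseteq> T" "finite S" "card S \<le> N" "\<forall>t\<in>T. \<exists>a\<in>S. \<rho> a t \<le> \<epsilon>"
    using assms(1) by blast
  have "\<forall>t\<in>T. \<exists>a\<in>S. \<rho> a t \<le> \<epsilon>'" using S(4) assms(3) by (meson order_trans)
  then show ?thesis using S(1,2) order_trans[OF S(3) assms(2)] by blast
qed

text \<open>Here \<open>s\<close> bounds the sparse operator norm and \<open>M\<close> the logarithm
  of the number of blocks. The condition on \<open>M * s\<close> serves twice: in the sampling
  bound, and for the levels below \<open>n1\<close>, where the net is the origin.\<close>

lemma gamma2_sparse_ball_le:
  fixes M s :: real
  assumes A: "A \<in> carrier_mat (m * B) d" "\<And>i j. i < m * B \<Longrightarrow> j < d \<Longrightarrow> cmod (A $$ (i, j)) \<le> 1"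
    and op: "\<And>b x. b < m \<Longrightarrow> x \<in> sparse_ball d k \<Longrightarrow> l2norm (row_block B A b *\<^sub>v x) \<le> s"
    and s: "0 \<le> s" and M: "1 \<le> M" "ln (real m) \<le> M" "M * s \<le> 2 * sqrt (real k * real B)"
    and pos: "0 < m" "0 < B" "0 < k" and d: "2 \<le> d" and Bk: "2 \<le> B * k"
  shows "gamma2 (sparse_ball d k) (\<lambda>x y. norm_X m B A (x - y))
    \<le> ennreal (8000 * (sqrt (real k * real B * ln (real d)) * ln (real B * real k)))"
proof -
  \<comment> \<open>The 5 is the exponent of the label count: lists of length \<open>L\<close> fit
    into \<open>2 ^ 2 ^ n\<close> as soon as \<open>D * L \<le> 2 ^ n\<close>.\<close>
  define D where "D = 5 * log 2 (real d)"
  have d0: "0 < d" using d by simp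
  have D5: "5 \<le> D"
  proof -
    have "log 2 2 \<le> log 2 (real d)" using d by (subst log_le_cancel_iff) auto
    then show ?thesis by (simp add: D_def)
  qed
  have k1: "1 \<le> real k" and B1: "1 \<le> real B" using pos by simp_all
  have M2: "1 \<le> M\<^sup>2" using M(1) by simp
  have y1: "10 \<le> 2 * D * M\<^sup>2"
    using mult_mono[of 10 "2 * D" 1 "M\<^sup>2"] D5 M2 by simp
  \<comment> \<open>From this level on \<open>2 ^ n / D\<close> is at least \<open>2 * M^2\<close>,
    enough for a sample size \<open>L \<ge> M^2\<close> after rounding down.\<close>
  obtain n1 where n1: "2 * D * M\<^sup>2 \<le> 2 ^ n1" "2 ^ n1 \<le> 4 * D * M\<^sup>2"
    using ex_dyadic_level[of "2 * D * M\<^sup>2"] y1 by (auto simp: max_def)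
  have k2: "1 \<le> (real k)\<^sup>2" using k1 by simp
  have y3: "1 \<le> 256 * (real k)\<^sup>2 * D"
    using mult_mono[of 1 "256 * (real k)\<^sup>2" 1 D] k2 D5 by simp
  \<comment> \<open>From this level on the grid of mesh \<open>1 / 2 ^ n\<close> fits:
    \<open>k * log 2 d\<close> and \<open>k * (2 * n + 4)\<close> are each at most
    \<open>2 ^ n / 2\<close>.\<close>
  obtain n3 where n3: "256 * (real k)\<^sup>2 * D \<le> 2 ^ n3" "2 ^ n3 \<le> 512 * (real k)\<^sup>2 * D"
    using ex_dyadic_level[of "256 * (real k)\<^sup>2 * D"] y3 by (auto simp: max_def split: if_splits)
  \<comment> \<open>If \<open>M\<close> is large, \<open>n3\<close> may lie below \<open>n1\<close>;
    the maximum then makes the middle range empty.\<close>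
  define n2 where "n2 = max n1 n3"
  define K where "K = 64 * sqrt (2 * real k * real B * D)"
  define G where "G = 2 * real k * sqrt (real B)"
  have K0: "0 \<le> K" and G0: "0 \<le> G" using D5 by (auto simp: K_def G_def)
  define e where "e = (\<lambda>n. if n < n1 then s else if n < n2 then K / sqrt 2 ^ n else G / 2 ^ n)"
  obtain X where X: "(\<lambda>n. sqrt 2 ^ n * e n) sums X"
    "X \<le> 3 * (sqrt 2 ^ n1 * s) + real (n2 - n1) * K + 4 * (G / sqrt 2 ^ n2)"
    using ex_chain_sum_le[of n1 n2 s K G] s K0 G0 unfolding e_def n2_def by auto
  have big: "16 * real k \<le> sqrt 2 ^ n" "256 * (real k * D) \<le> 2 ^ n" if "n2 \<le> n" for n
  proof -
    have "(2::real) ^ n3 \<le> 2 ^ n" using that by (intro power_increasing) (auto simp: n2_def)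
    then have b: "256 * (real k)\<^sup>2 * D \<le> 2 ^ n" using n3 by linarith
    have "256 * (real k * D) \<le> 256 * (real k * D * real k)"
      using k1 D5 by (intro mult_left_mono mult_left_mono[of 1 _ "real k * D", simplified]) auto
    then show "256 * (real k * D) \<le> 2 ^ n" using b by (simp add: power2_eq_square mult_ac)
    have "(16 * real k)\<^sup>2 \<le> 256 * (real k)\<^sup>2 * D"
      using mult_left_mono[of 1 D "256 * (real k)\<^sup>2"] D5 by (simp add: power_mult_distrib)
    then have "(16 * real k)\<^sup>2 \<le> (sqrt 2 ^ n)\<^sup>2" using b by (simp only: sqrt2_power_sq)
    then show "16 * real k \<le> sqrt 2 ^ n" by (rule power2_le_imp_le) simp
  qed
  have cov: "\<exists>S\<subseteq>sparse_ball d k. finite S \<and> card S \<le> 2 ^ 2 ^ n \<and>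
      (\<forall>t\<in>sparse_ball d k. \<exists>a\<in>S. norm_X m B A (a - t) \<le> e n)" for n
  proof -
    consider "n < n1" | "n1 \<le> n" "n < n2" | "n1 \<le> n" "n2 \<le> n" by linarith
    then show ?thesis
    proof cases
      case 1
      have "{i. i < d \<and> 0\<^sub>v d $ i \<noteq> (0::complex)} = {}" by auto
      then have "card {i. i < d \<and> 0\<^sub>v d $ i \<noteq> (0::complex)} \<le> k" by (simp only: card.empty le0)
      then have z: "0\<^sub>v d \<in> sparse_ball d k" by (simp add: sparse_ball_def l2norm_def)
      have "norm_X m B A (0\<^sub>v d - t) \<le> e n" if t: "t \<in> sparse_ball d k" for t
      proof -
        have tc: "t \<in> carrier_vec d" using t by (simp add: sparse_ball_def)
        show ?thesis using 1 op[OF _ t]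
          unfolding norm_X_diff_le_iff[OF A(1) zero_carrier_vec tc pos(1)]
          by (simp add: l2norm_row_block[OF A(1) tc] e_def)
      qed
      then show ?thesis using z by (intro exI[of _ "{0\<^sub>v d}"]) auto
    next
      case 2
      define y where "y = 2 ^ n / D"
      define L where "L = nat \<lfloor>y\<rfloor>"
      have "(2::real) ^ n1 \<le> 2 ^ n" using 2 by (intro power_increasing) auto
      then have "2 * D * M\<^sup>2 \<le> 2 ^ n" using n1 by linarith
      then have yM: "2 * M\<^sup>2 \<le> y" using D5 by (simp add: y_def le_divide_eq mult_ac)
      \<comment> \<open>Rounding down loses at most 1, and \<open>y \<ge> 2 * M^2 \<ge> 2\<close>,
        so \<open>L\<close> keeps at least \<open>y / 2\<close> and at least
        \<open>M^2\<close>.\<close>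
      have Ly: "real L \<le> y" "y - 1 \<le> real L"
        using yM M2 unfolding L_def by linarith+
      have LM: "M\<^sup>2 \<le> real L" and Ly2: "y / 2 \<le> real L" using Ly yM M2 by linarith+
      have L0: "0 < real L" using LM M2 by linarith
      have "real (5 * L) * log 2 (real d) = D * real L" by (simp add: D_def)
      also have "\<dots> \<le> 2 ^ n" using Ly D5 by (simp add: y_def le_divide_eq mult_ac)
      finally have "d ^ (5 * L) * 2 ^ 0 \<le> (2::nat) ^ (2 ^ n)"
        by (intro pow_mult_pow2_le d0) simp
      moreover have "(4 * d * (d + 1)) ^ L \<le> (d ^ 5) ^ L"
        by (intro power_mono label_count_le d) simp
      ultimately have N: "(4 * d * (d + 1)) ^ L \<le> 2 ^ 2 ^ n" by (simp add: power_mult)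
      have "64 * sqrt (real k * real B / real L) \<le> K / sqrt 2 ^ n"
      proof -
        have "real k * real B / real L \<le> real k * real B / (y / 2)"
          using Ly2 yM M2 by (intro divide_left_mono) auto
        also have "\<dots> = 2 * real k * real B * D / 2 ^ n" by (simp add: y_def)
        finally have "sqrt (real k * real B / real L) \<le> sqrt (2 * real k * real B * D / 2 ^ n)"
          by (rule real_sqrt_le_mono)
        also have "\<dots> = sqrt (2 * real k * real B * D) / sqrt 2 ^ n"
          by (simp only: real_sqrt_divide real_sqrt_power)
        finally show ?thesis by (simp add: K_def)
      qed
      also have "\<dots> = e n" using 2 by (simp add: e_def)
      finally have E: "64 * sqrt (real k * real B / real L) \<le> e n" .
      have "\<exists>S\<subseteq>sparse_ball d k. finite S \<and> card S \<le> (4 * d * (d + 1)) ^ L \<and>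
        (\<forall>t\<in>sparse_ball d k. \<exists>a\<in>S. norm_X m B A (a - t) \<le> 64 * sqrt (real k * real B / real L))"
        by (rule ex_maurey_cover) (fact A op s M LM pos d0)+
      then show ?thesis by (rule cover_mono[OF _ N E])
    next
      case 3
      have "real (k * (2 * n + 4)) \<le> 2 ^ n / 2"
      proof -
        have "real (k * (2 * n + 4)) = (2 * real k) * (real n + 2)" by (simp add: algebra_simps)
        also have "\<dots> \<le> (sqrt 2 ^ n / 8) * (4 * sqrt 2 ^ n)"
          using big(1)[OF 3(2)] add_two_le_sqrt2_power[of n] by (intro mult_mono) auto
        also have "\<dots> = 2 ^ n / 2" using sqrt2_power_sq[of n] by (simp add: power2_eq_square)
        finally show ?thesis .
      qed
      moreover have "real k * log 2 (real d) \<le> 2 ^ n / 2"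
      proof -
        have "real k * log 2 (real d) = real k * D / 5" by (simp add: D_def)
        also have "\<dots> \<le> 256 * (real k * D) / 2" using D5 by simp
        also have "\<dots> \<le> 2 ^ n / 2" using big(2)[OF 3(2)] by (simp add: mult.commute)
        finally show ?thesis .
      qed
      ultimately have "d ^ k * 2 ^ (k * (2 * n + 4)) \<le> (2::nat) ^ (2 ^ n)"
        by (intro pow_mult_pow2_le d0) simp
      then have N: "(d * 2 ^ (2 * n + 4)) ^ k \<le> 2 ^ 2 ^ n"
        by (simp only: power_mult_distrib power_mult[symmetric] mult.commute[of k])
      \<comment> \<open>The mesh exponent is the level \<open>n\<close> itself, so the error decays
        like \<open>1 / 2 ^ n\<close> and outweighs the factor \<open>sqrt 2 ^ n\<close>.\<close>
      have E: "2 * real k * sqrt (real B) / 2 ^ n \<le> e n" using 3 by (simp add: e_def G_def)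
      have "\<exists>S\<subseteq>sparse_ball d k. finite S \<and> card S \<le> (d * 2 ^ (2 * n + 4)) ^ k \<and>
        (\<forall>t\<in>sparse_ball d k. \<exists>a\<in>S. norm_X m B A (a - t) \<le> 2 * real k * sqrt (real B) / 2 ^ n)"
        by (rule ex_grid_cover) (fact A pos d0)+
      then show ?thesis by (rule cover_mono[OF _ N E])
    qed
  qed
  have "gamma2 (sparse_ball d k) (\<lambda>x y. norm_X m B A (x - y)) \<le> ennreal X"
    by (rule gamma2_le_suminf[OF cov _ X(1)]) (use s K0 G0 in \<open>auto simp: e_def\<close>)
  also have "ennreal X \<le> ennreal (8000 * (sqrt (real k * real B * ln (real d)) * ln (real B * real k)))"
  proof (rule ennreal_leI)
    define q where "q = sqrt (real k * real B * ln (real d))"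
    define l where "l = ln (real B * real k)"
    have ln2: "1/2 \<le> ln (2::real)" 
      using ln_le_minus_one[of "1/2"] by (simp add: ln_div)
    have lnd: "ln 2 \<le> ln (real d)" using d by simp
    have Bk': "2 \<le> real B * real k" using Bk by (metis of_nat_le_iff of_nat_mult of_nat_numeral)
    have l2: "ln 2 \<le> l" unfolding l_def using Bk' by (subst ln_le_cancel_iff) auto
    have lk: "ln (real k) \<le> l"
      unfolding l_def using Bk' k1 B1 mult_right_mono[of 1 "real B" "real k"]
      by (subst ln_le_cancel_iff) auto
    have q0: "0 \<le> q" unfolding q_def using lnd ln2 by simp
    \<comment> \<open>Since \<open>l \<ge> ln 2 \<ge> 1/2\<close>, terms without the logarithmic
      factor can be absorbed at the price of a factor 2.\<close>
    have ql: "q \<le> 2 * (q * l)" using mult_left_mono[of 1 "2 * l" q] l2 ln2 q0 by simp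
    have Dln: "D \<le> 10 * ln (real d)"
    proof -
      have "ln (real d) / ln 2 \<le> ln (real d) / (1/2)"
        using ln2 lnd by (intro divide_left_mono) auto
      then show ?thesis by (simp add: D_def log_def)
    qed
    have kBD: "sqrt (real k * real B * D) \<le> 4 * q"
    proof -
      have "real k * real B * D \<le> real k * real B * (16 * ln (real d))"
        using Dln lnd ln2 by (intro mult_left_mono) auto
      also have "\<dots> = 16 * (real k * real B * ln (real d))" by simp
      finally have "sqrt (real k * real B * D) \<le> sqrt (16 * (real k * real B * ln (real d)))"
        by (rule real_sqrt_le_mono)
      also have "\<dots> = 4 * q"
        unfolding q_def using real_sqrt_mult[of "4\<^sup>2" "real k * real B * ln (real d)"] by simp
      finally show ?thesis .
    qed
    have t1: "3 * (sqrt 2 ^ n1 * s) \<le> 96 * (q * l)"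
    proof -
      have "(sqrt 2 ^ n1)\<^sup>2 \<le> (2 * M * sqrt D)\<^sup>2"
        unfolding sqrt2_power_sq using n1(2) D5 by (simp add: power_mult_distrib mult_ac)
      then have "sqrt 2 ^ n1 \<le> 2 * M * sqrt D" by (rule power2_le_imp_le) (use M D5 in simp)
      then have "3 * (sqrt 2 ^ n1 * s) \<le> 3 * ((2 * M * sqrt D) * s)"
        using s by (intro mult_left_mono mult_right_mono) auto
      \<comment> \<open>The factor \<open>M\<close> in \<open>sqrt 2 ^ n1\<close> meets
        \<open>s\<close>, so the assumption on \<open>M * s\<close> applies.\<close>
      also have "\<dots> = 6 * sqrt D * (M * s)" by simp
      also have "\<dots> \<le> 6 * sqrt D * (2 * sqrt (real k * real B))"
        using M(3) D5 by (intro mult_left_mono) auto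
      also have "\<dots> = 12 * sqrt (real k * real B * D)" by (simp add: real_sqrt_mult)
      also have "\<dots> \<le> 48 * q" using kBD by simp
      finally show ?thesis using ql by linarith
    qed
    have t2: "real (n2 - n1) * K \<le> 7680 * (q * l)"
    proof -
      \<comment> \<open>In the ratio \<open>2 ^ n3 / 2 ^ n1\<close> the factor \<open>D\<close>
        cancels and at most \<open>2 ^ 8 * k^2\<close> remains; its logarithm is at most
        \<open>8 l + 2 l\<close>, free of \<open>d\<close>.\<close>
      have "real (n2 - n1) * ln 2 \<le> 10 * l"
      proof (cases "n3 \<le> n1")
        case True
        then show ?thesis using l2 ln2 by (simp add: n2_def)
      next
        case False
        have "(2::real) ^ (n3 - n1) = 2 ^ n3 / 2 ^ n1" using False by (simp add: power_diff)
        also have "\<dots> \<le> (512 * (real k)\<^sup>2 * D) / (2 * D * M\<^sup>2)"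
          using n1 n3 y1 D5 by (intro frac_le) auto
        also have "\<dots> \<le> (512 * (real k)\<^sup>2 * D) / (2 * D * 1)"
          using M M2 D5 by (intro divide_left_mono mult_left_mono) auto
        also have "\<dots> = 2 ^ 8 * (real k)\<^sup>2" using D5 by simp
        finally have "ln ((2::real) ^ (n3 - n1)) \<le> ln (2 ^ 8 * (real k)\<^sup>2)"
          using k1 by (subst ln_le_cancel_iff) auto
        also have "\<dots> = 8 * ln 2 + 2 * ln (real k)"
          using k1 ln_mult[of "2 ^ 8" "(real k)\<^sup>2"] ln_realpow[of 2 8] ln_realpow[of "real k" 2]
          by simp
        finally have "real (n3 - n1) * ln 2 \<le> 8 * ln 2 + 2 * ln (real k)"
          by (simp add: ln_realpow)
        moreover have "n2 - n1 = n3 - n1" using False by (simp add: n2_def)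
        ultimately show ?thesis using l2 lk by simp
      qed
      moreover have "real (n2 - n1) * (1/2) \<le> real (n2 - n1) * ln 2"
        using ln2 by (intro mult_left_mono) auto
      ultimately have nn: "real (n2 - n1) \<le> 20 * l" by simp
      have "sqrt (2 * real k * real B * D) = sqrt 2 * sqrt (real k * real B * D)"
        by (simp add: real_sqrt_mult)
      also have "\<dots> \<le> (3/2) * (4 * q)"
        using sqrt2_bounds(2) kBD D5 by (intro mult_mono) auto
      finally have "K \<le> 384 * q" by (simp add: K_def)
      then have "real (n2 - n1) * K \<le> (20 * l) * (384 * q)"
        using nn K0 l2 ln2 by (intro mult_mono) auto
      then show ?thesis by (simp add: mult.commute)
    qed
    have t3: "4 * (G / sqrt 2 ^ n2) \<le> 2 * (q * l)"
    proof -
      have "G / sqrt 2 ^ n2 \<le> G / (16 * real k)"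
        using big(1)[of n2] k1 G0 by (intro divide_left_mono) auto
      also have "\<dots> = sqrt (real B) / 8" unfolding G_def using k1 by simp
      also have "sqrt (real B) \<le> sqrt (4 * (real k * real B * ln (real d)))"
      proof (rule real_sqrt_le_mono)
        have "1 * real B * (1/4) \<le> real k * real B * ln (real d)"
          using k1 lnd ln2 by (intro mult_mono) auto
        then show "real B \<le> 4 * (real k * real B * ln (real d))" by simp
      qed
      also have "\<dots> = 2 * q" unfolding q_def by (simp only: real_sqrt_mult real_sqrt_four)
      finally show ?thesis using ql by linarith
    qed
    \<comment> \<open>The three ranges contribute \<open>96 + 7680 + 2\<close> times
      \<open>q * l\<close>, which is below 8000.\<close>
    have "0 \<le> q * l" using q0 l2 ln2 by simp
    then show "X \<le> 8000 * (sqrt (real k * real B * ln (real d)) * ln (real B * real k))"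
      using X(2) t1 t2 t3 unfolding q_def l_def by linarith
  qed
  finally show ?thesis .
qed

text \<open>For \<open>d = 1\<close> or \<open>B * k = 1\<close> a logarithm on the right vanishes
  while the functional can be positive, hence the conditions \<open>d \<ge> 2\<close> and
  \<open>B * k \<ge> 2\<close>. The proof turns the assumptions into the single condition on
  \<open>M * s\<close>.\<close>

theorem theorem6:
  "\<exists>C::real. C > 0 \<and>
     (\<forall>(d::nat) (k::nat) (m::nat) (B::nat) (Q1::real) (Q2::real) (A::complex mat).
        d > 0 \<longrightarrow> k > 0 \<longrightarrow> m > 0 \<longrightarrow> B > 0 \<longrightarrow> Q1 > 0 \<longrightarrow> Q2 > 0 \<longrightarrow>
        d \<ge> 2 \<longrightarrow> B * k \<ge> 2 \<longrightarrow>
        A \<in> carrier_mat (m * B) d \<longrightarrow>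
        (\<forall>i<m * B. \<forall>j<d. cmod (A $$ (i, j)) \<le> 1) \<longrightarrow>
        (\<forall>s::nat. 1 \<le> s \<and> s \<le> 2 * k \<longrightarrow>
           (MAX b\<in>{..<m}. SUP x\<in>sparse_ball d s. l2norm (row_block B A b *\<^sub>v x))
             \<le> Q1 * sqrt (real B) + Q2 * sqrt (real s)) \<longrightarrow>
        real B \<ge> max (Q2\<^sup>2 * (ln (real m))\<^sup>2) (Q1\<^sup>2 * ln (real m) * ln (real k)) \<longrightarrow>
        real k \<ge> Q1\<^sup>2 * (ln (real m))\<^sup>2 \<longrightarrow>
        gamma2 (sparse_ball d k) (\<lambda>x y. norm_X m B A (x - y))
          \<le> ennreal (C * (sqrt (real k * real B * ln (real d)) * ln (real B * real k))))"
proof (rule exI[of _ 8000], intro conjI allI impI)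
  fix d k m B :: nat and Q1 Q2 :: real and A :: "complex mat"
  assume pos: "0 < d" "0 < k" "0 < m" "0 < B" "0 < Q1" "0 < Q2"
    and d: "2 \<le> d" and Bk: "2 \<le> B * k"
    and A: "A \<in> carrier_mat (m * B) d" "\<forall>i<m * B. \<forall>j<d. cmod (A $$ (i, j)) \<le> 1"
    and rip: "\<forall>s::nat. 1 \<le> s \<and> s \<le> 2 * k \<longrightarrow>
           (MAX b\<in>{..<m}. SUP x\<in>sparse_ball d s. l2norm (row_block B A b *\<^sub>v x))
             \<le> Q1 * sqrt (real B) + Q2 * sqrt (real s)"
    and B: "max (Q2\<^sup>2 * (ln (real m))\<^sup>2) (Q1\<^sup>2 * ln (real m) * ln (real k)) \<le> real B"
    and k: "Q1\<^sup>2 * (ln (real m))\<^sup>2 \<le> real k"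
  define M where "M = max 1 (ln (real m))"
  define \<sigma> where "\<sigma> = Q1 * sqrt (real B) + Q2 * sqrt (real k)"
  \<comment> \<open>The minimum with the trivial bound covers the case \<open>ln m \<le> 1\<close>,
    where the assumptions relating \<open>B\<close> and \<open>k\<close> to \<open>ln m\<close> do
    not control \<open>\<sigma>\<close>.\<close>
  define s where "s = min \<sigma> (sqrt (real k * real B))"
  have m0: "0 \<le> ln (real m)" using pos by simp
  have entries: "cmod (A $$ (i, j)) \<le> 1" if "i < m * B" "j < d" for i j
    using A(2) that by blast
  have op: "l2norm (row_block B A b *\<^sub>v x) \<le> s" if b: "b < m" and x: "x \<in> sparse_ball d k" for b x
  proof -
    let ?f = "\<lambda>b. SUP x\<in>sparse_ball d k. l2norm (row_block B A b *\<^sub>v x)"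
    have bnd: "l2norm (row_block B A b *\<^sub>v y) \<le> sqrt (real k * real B)" if "y \<in> sparse_ball d k" for y
      by (rule row_block_norm_le[OF A(1) entries b pos(1,2) that])
    \<comment> \<open>A real supremum dominates its members only over a bounded set; the trivial
      bound supplies boundedness.\<close>
    have "l2norm (row_block B A b *\<^sub>v x) \<le> ?f b"
      by (rule cSUP_upper[OF x]) (rule bdd_aboveI2[OF bnd])
    also have "\<dots> \<le> Max (?f ` {..<m})" using b by (intro Max_ge) auto
    also have "\<dots> \<le> \<sigma>" unfolding \<sigma>_def using rip pos by simp
    finally show ?thesis using bnd[OF x] by (simp add: s_def)
  qed
  have Ms: "M * s \<le> 2 * sqrt (real k * real B)"
  proof (cases "ln (real m) \<le> 1")
    case True
    then have "M * s = s" by (simp add: M_def)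
    also have "s \<le> sqrt (real k * real B)" by (simp add: s_def)
    also have "\<dots> \<le> 2 * sqrt (real k * real B)" by simp
    finally show ?thesis .
  next
    case False
    \<comment> \<open>The two size assumptions pair crosswise with \<open>\<sigma>\<close>: the
      bound on \<open>Q1 * ln m\<close> by \<open>sqrt k\<close> meets \<open>sqrt B\<close>, and
      the bound on \<open>Q2 * ln m\<close> by \<open>sqrt B\<close> meets
      \<open>sqrt k\<close>.\<close>
    have "(Q1 * ln (real m))\<^sup>2 \<le> real k" "(Q2 * ln (real m))\<^sup>2 \<le> real B"
      using B k by (simp_all add: power_mult_distrib)
    then have "Q1 * ln (real m) \<le> sqrt (real k)" "Q2 * ln (real m) \<le> sqrt (real B)"
      by (auto intro: real_le_rsqrt)
    then have "(Q1 * ln (real m)) * sqrt (real B) + (Q2 * ln (real m)) * sqrt (real k)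
        \<le> sqrt (real k) * sqrt (real B) + sqrt (real B) * sqrt (real k)"
      by (intro add_mono mult_right_mono) auto
    then have "M * \<sigma> \<le> 2 * sqrt (real k * real B)"
      using False unfolding M_def \<sigma>_def by (simp add: max_def real_sqrt_mult algebra_simps)
    moreover have "M * s \<le> M * \<sigma>" unfolding M_def s_def by (intro mult_left_mono) auto
    ultimately show ?thesis by linarith
  qed
  show "gamma2 (sparse_ball d k) (\<lambda>x y. norm_X m B A (x - y))
      \<le> ennreal (8000 * (sqrt (real k * real B * ln (real d)) * ln (real B * real k)))"
  proof (rule gamma2_sparse_ball_le)
    show "0 \<le> s" using pos by (simp add: s_def \<sigma>_def)
    show "1 \<le> M" "ln (real m) \<le> M" by (simp_all add: M_def)
  qed (fact A(1) entries op Ms pos d Bk)+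
qed simp

end
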